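(* Let $f,g\in H^1(\mathbb{D})$ satisfy $|f|=|g|$ almost everywhere on $\mathbb{T}$ (in the sense of radial limits) and $|f|=|g|$ on an infinite subset $X\subset r\mathbb{T}$ for some $0<r<1$. Then $f=\lambda g$ for some $\lambda\in\mathbb{T}$.
   Context: $\mathbb{D}$ is the open unit disc, $\mathbb{T}$ the unit circle, $r\mathbb{T}=\{z:|z|=r\}$, and $H^1(\mathbb{D})$ is the Hardy space of the disc. *)

theory Defs
  imports "HOL-Analysis.Analysis"
begin

definition hardy1 :: "(complex \<Rightarrow> complex) \<Rightarrow> bool" where
  "hardy1 f \<longleftrightarrow> f holomorphic_on ball 0 1 \<and>
     (\<exists>C. \<forall>r. 0 < r \<and> r < 1 \<longrightarrow>
        integral {0..2*pi} (\<lambda>t. norm (f (complex_of_real r * cis t))) \<le> C)"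

definition radial_limit :: "(complex \<Rightarrow> complex) \<Rightarrow> real \<Rightarrow> complex" where
  "radial_limit f t = Lim (at_left 1) (\<lambda>\<rho>::real. f (complex_of_real \<rho> * cis t))"

end

theory Submission
  imports Defs "HOL-Complex_Analysis.Complex_Analysis"
begin

text \<open>Reflecting the zeros of \<open>f\<close> and \<open>g\<close> inside the circle \<open>|z| = r\<close> shows that equality of moduli on that
  circle forces \<open>f / g\<close> to be a rational function \<open>R\<close>. Almost everywhere on the unit circle \<open>f\<close> and \<open>g\<close> have
  nonzero radial limits of equal modulus, so \<open>|R| = 1\<close> there as well. Schwarz reflection in both circles
  gives \<open>R (r\<^sup>2 z) = R z\<close>, hence \<open>R\<close> is constant.

  The radial limits come from writing a Hardy function as a quotient of bounded functions. For a bounded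
  function \<open>h\<close> the primitive is Lipschitz up to the boundary, hence differentiable almost everywhere
  along the circle, and at such a point \<open>h\<close> has a radial limit.\<close>

subsection \<open>Cauchy and Poisson formulas on the unit circle\<close>

text \<open>On the unit circle only radial limits almost everywhere are available, so the identity
  theorem cannot act there directly. The circle of radius \<open>r\<close> therefore has to yield
  rationality of the ratio alone; after that, infinitely many points of the unit circle carry all
  the information, and almost every point is more than enough. Equality is given only on the
  infinite set \<open>X\<close>. It spreads to the whole circle because
  \<open>f z * cnj (f (r^2 / cnj z))\<close> is holomorphic on the annulus between radii
  \<open>r^2\<close> and \<open>1\<close> and restricts to \<open>|f|^2\<close> on the circle.
  \<open>radial_limit\<close> has an unspecified value where no limit exists, so the boundary
  hypothesis gains content only from existence of limits; they must also be nonzero to be cancelled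
  from the relation \<open>f * Q = g * P\<close>, the form in which the ratio is carried. Invariance
  of \<open>R\<close> under scaling by \<open>s = r^2\<close> forces constancy at the origin: if
  \<open>R\<close> behaves like \<open>c * z^k\<close> there, then \<open>s^k = 1\<close>, so
  \<open>k = 0\<close>; now \<open>R - c\<close> is also invariant but has positive order at 0,
  hence is zero.\<close>

lemma circlepath_has_integral_cis:
  assumes "(F has_contour_integral I) (circlepath 0 1)"
  shows "((\<lambda>t. F (cis t) * cis t) has_integral I / \<i>) {0..2*pi}"
proof -
  have "((\<lambda>t. F (0 + of_real 1 * cis t) * of_real 1 * \<i> * cis t) has_integral I) {0..2*pi}"
    using assms unfolding circlepath_def
    by (subst (asm) has_contour_integral_part_circlepath_iff) simp_all
  from has_integral_divide[OF this, of \<i>] show ?thesis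
    by (rule has_integral_eq[rotated]) (simp add: field_simps)
qed

lemma Cauchy_formula_cis:
  fixes f :: "complex \<Rightarrow> complex"
  assumes "continuous_on (cball 0 1) f" "f holomorphic_on ball 0 1" "norm z < 1"
  shows "((\<lambda>t. f (cis t) * (cis t / (cis t - z))) has_integral 2 * pi * f z) {0..2*pi}"
proof -
  have "((\<lambda>u. f u / (u - z)) has_contour_integral (2 * of_real pi * \<i> * f z)) (circlepath 0 1)"
    using Cauchy_integral_circlepath[OF assms(1,2), of z] assms(3) by simp
  from circlepath_has_integral_cis[OF this] show ?thesis by (simp add: mult_ac)
qed

lemma Cauchy_derivative_formula_cis:
  fixes f :: "complex \<Rightarrow> complex"
  assumes "continuous_on (cball 0 1) f" "f holomorphic_on ball 0 1" "norm z < 1"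
  shows "((\<lambda>t. f (cis t) * (cis t / (cis t - z)^2)) has_integral 2 * pi * deriv f z) {0..2*pi}"
proof -
  have "((\<lambda>u. f u / (u - z)^2) has_contour_integral 2 * of_real pi * \<i> * deriv f z) (circlepath 0 1)"
  proof -
    have "((\<lambda>u. f u / (u - z) ^ (Suc 1)) has_contour_integral ((2 * pi * \<i>) / (fact 1) * (deriv ^^ 1) f z)) (circlepath 0 1)"
      by (rule Cauchy_has_contour_integral_higher_derivative_circlepath) (use assms in auto)
    then show ?thesis by (simp add: power2_eq_square)
  qed
  from circlepath_has_integral_cis[OF this] show ?thesis by (simp add: mult_ac)
qed

lemma Cauchy_theorem_cis:
  fixes f :: "complex \<Rightarrow> complex"
  assumes "continuous_on (cball 0 1) f" "f holomorphic_on ball 0 1"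
  shows "((\<lambda>t. f (cis t) * cis t) has_integral 0) {0..2*pi}"
proof -
  have "continuous_on (cball 0 1) (\<lambda>z. z * f z)" "(\<lambda>z. z * f z) holomorphic_on ball 0 1"
    using assms by (auto intro!: continuous_intros holomorphic_intros)
  from Cauchy_formula_cis[OF this, of 0] show ?thesis by (simp add: mult_ac)
qed

lemma mean_value_cis:
  fixes f :: "complex \<Rightarrow> complex"
  assumes "continuous_on (cball 0 1) f" "f holomorphic_on ball 0 1"
  shows "((\<lambda>t. f (cis t)) has_integral 2 * pi * f 0) {0..2*pi}"
  using Cauchy_formula_cis[OF assms, of 0] by simp

text \<open>On the unit circle \<open>cnj \<zeta> = 1 / \<zeta>\<close>, which turns the conjugate
  half of the kernel into \<open>\<zeta>\<close> times a function of \<open>\<zeta>\<close>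
  holomorphic across the closed disc. Cauchy's theorem kills that half, so against holomorphic
  functions the Poisson kernel acts like the Cauchy kernel.\<close>

lemma poisson_kernel_decomp:
  fixes z \<zeta> :: complex
  assumes "norm z < 1" "norm \<zeta> = 1"
  shows "complex_of_real ((1 - (norm z)^2) / (norm (\<zeta> - z))^2)
       = \<zeta> / (\<zeta> - z) + cnj z / (1 - cnj z * \<zeta>) * \<zeta>"
proof -
  have nz: "\<zeta> \<noteq> z" "\<zeta> \<noteq> 0" using assms by auto
  have c1: "\<zeta> * cnj \<zeta> = 1" by (metis assms(2) complex_norm_square of_real_1 one_power2)
  have e: "1 - cnj z * \<zeta> = \<zeta> * cnj (\<zeta> - z)" using c1 by (simp add: algebra_simps)
  have n: "cnj (\<zeta> - z) \<noteq> 0" "\<zeta> - z \<noteq> 0" using nz by auto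
  have "complex_of_real ((1 - (norm z)^2) / (norm (\<zeta> - z))^2)
      = (1 - z * cnj z) / ((\<zeta> - z) * cnj (\<zeta> - z))"
    by (simp only: of_real_divide of_real_diff of_real_1 complex_norm_square)
  also have "1 - z * cnj z = \<zeta> * cnj (\<zeta> - z) + cnj z * (\<zeta> - z)"
    using c1 by (simp add: algebra_simps)
  also have "\<dots> / ((\<zeta> - z) * cnj (\<zeta> - z)) = \<zeta> / (\<zeta> - z) + cnj z / cnj (\<zeta> - z)"
    using n by (simp add: add_divide_distrib)
  also have "cnj z / cnj (\<zeta> - z) = cnj z / (1 - cnj z * \<zeta>) * \<zeta>"
    unfolding e using nz by simp
  finally show ?thesis .
qed

lemma Poisson_formula_cis:
  fixes f :: "complex \<Rightarrow> complex"
  assumes f: "continuous_on (cball 0 1) f" "f holomorphic_on ball 0 1" and z: "norm z < 1"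
  shows "((\<lambda>t. f (cis t) * complex_of_real ((1 - (norm z)^2) / (norm (cis t - z))^2))
            has_integral 2 * pi * f z) {0..2*pi}"
proof -
  have nz: "1 - cnj z * w \<noteq> 0" if "norm w \<le> 1" for w
  proof
    assume "1 - cnj z * w = 0"
    then have "cnj z * w = 1" by simp
    then have "norm z * norm w = 1" by (metis complex_mod_cnj norm_mult norm_one)
    moreover have "norm z * norm w \<le> norm z * 1" using that by (intro mult_left_mono) auto
    ultimately show False using z by simp
  qed
  have "continuous_on (cball 0 1) (\<lambda>w. f w * (cnj z / (1 - cnj z * w)))"
    "(\<lambda>w. f w * (cnj z / (1 - cnj z * w))) holomorphic_on ball 0 1"
    using f nz by (auto intro!: continuous_intros holomorphic_intros)
  from has_integral_add[OF Cauchy_formula_cis[OF f z] Cauchy_theorem_cis[OF this]]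
  have "((\<lambda>t. f (cis t) * (cis t / (cis t - z)) +
      f (cis t) * (cnj z / (1 - cnj z * cis t)) * cis t) has_integral 2 * pi * f z) {0..2*pi}"
    by (simp only: add_0_right)
  then show ?thesis
    by (rule has_integral_eq[rotated])
      (simp only: poisson_kernel_decomp[OF z norm_cis] distrib_left mult.assoc)
qed

lemma Poisson_kernel_has_integral:
  fixes z :: complex
  assumes z: "norm z < 1"
  shows "((\<lambda>t. (1 - (norm z)^2) / (norm (cis t - z))^2) has_integral 2 * pi) {0..2*pi}"
proof -
  have "((\<lambda>t. complex_of_real ((1 - (norm z)^2) / (norm (cis t - z))^2)) has_integral 2 * pi) {0..2*pi}"
    using Poisson_formula_cis[of "\<lambda>_. 1" z] z by (simp only: mult_1_left mult_1_right continuous_on_const holomorphic_on_const simp_thms True_implies_equals)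
  from has_integral_linear[OF this bounded_linear_Re] show ?thesis
    by (simp only: o_def Re_complex_of_real)
qed

subsection \<open>Lipschitz functions on the line\<close>

text \<open>Pushing Lebesgue measure forward along the inverse of \<open>H\<close> gives the Stieltjes measure of \<open>H\<close>, and
  absolute continuity becomes the fact that Lipschitz images of null sets are null.\<close>

lemma has_integral_density_of_bilipschitz:
  fixes H :: "real \<Rightarrow> real"
  assumes K: "0 < K"
    and lower: "\<And>s t. s \<le> t \<Longrightarrow> K * (t - s) \<le> H t - H s"
    and upper: "\<And>s t. s \<le> t \<Longrightarrow> H t - H s \<le> M * (t - s)"
  obtains h where "\<And>a b. a \<le> b \<Longrightarrow> (h has_integral (H b - H a)) {a..b}"
proof -
  have mono: "H s \<le> H t \<longleftrightarrow> s \<le> t" for s t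
  proof -
    have "H s \<le> H t" if "s \<le> t" for s t using lower[OF that] mult_nonneg_nonneg[of K "t - s"] K that by linarith
    moreover have "H s < H t" if "s < t" for s t using lower[of s t] mult_pos_pos[of K "t - s"] K that by linarith
    ultimately show ?thesis by (meson linorder_not_le)
  qed
  have lip: "\<bar>H s - H t\<bar> \<le> M * \<bar>s - t\<bar>" for s t
    using upper[of s t] upper[of t s] mono[of s t] mono[of t s] by (cases "s \<le> t") auto
  have contH: "continuous_on A H" for A
    by (rule lipschitz_on_continuous_on[of "\<bar>M\<bar>"], rule lipschitz_onI)
      (auto simp: dist_real_def intro!: order_trans[OF lip] mult_right_mono)
  have surj: "\<exists>x. H x = y" for y
  proof -
    \<comment> \<open>The slope is at least \<open>K\<close>, so over a length \<open>n\<close> the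
      function moves by at least \<open>|y| + |H 0|\<close>, enough to pass \<open>y\<close> on
      either side of 0.\<close>
    define n where "n = (\<bar>y\<bar> + \<bar>H 0\<bar>) / K"
    have n: "0 \<le> n" "K * n = \<bar>y\<bar> + \<bar>H 0\<bar>" using K by (auto simp: n_def)
    have "H (-n) \<le> y" using lower[of "-n" 0] n by simp
    moreover have "y \<le> H n" using lower[of 0 n] n by simp
    ultimately show ?thesis using IVT'[of H "-n" y n] n contH by auto
  qed
  define J where "J = (\<lambda>y. THE x. H x = y)"
  have JH: "J (H x) = x" for x
    unfolding J_def by (rule the_equality) (auto intro!: antisym simp flip: mono)
  have HJ: "H (J y) = y" for y using surj[of y] JH by auto
  have JA: "J -` A = H ` A" for A
  proof (intro set_eqI iffI)
    fix y assume "y \<in> J -` A"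
    then show "y \<in> H ` A" using HJ[of y] by (intro image_eqI[of y H "J y"]) auto
  next
    fix y assume "y \<in> H ` A"
    then show "y \<in> J -` A" by (auto simp: JH)
  qed
  have monoJ: "J s \<le> J t \<longleftrightarrow> s \<le> t" for s t by (metis mono HJ)
  have Jm: "J \<in> borel_measurable borel"
    by (rule borel_measurable_mono) (auto simp: monoJ mono_def)
  define N where "N = distr lborel borel J"
  have sN: "sets N = sets lborel" by (simp add: N_def)
  have eN: "emeasure N A = emeasure lborel (H ` A)" if "A \<in> sets borel" for A
  proof -
    have "J -` A = H ` A" by (rule JA)
    then show ?thesis using that Jm by (simp add: N_def emeasure_distr)
  qed
  have ac: "absolutely_continuous lborel N"
    unfolding absolutely_continuous_def
  proof
    fix A :: "real set" assume A: "A \<in> null_sets lborel"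
    then have Ab: "A \<in> sets borel" by auto
    have "negligible A" using A by (simp add: negligible_iff_null_sets null_sets_completionI)
    then have "negligible (H ` A)"
      by (rule negligible_locally_Lipschitz_image[rotated])
        (auto intro!: exI[of _ UNIV] exI[of _ M] simp: lip)
    moreover have "H ` A \<in> sets borel"
    proof -
      have "J -` A \<inter> space borel \<in> sets borel" using Jm Ab by (rule measurable_sets)
      moreover have "J -` A = H ` A" by (rule JA)
      ultimately show ?thesis by simp
    qed
    ultimately have "emeasure lborel (H ` A) = 0"
      by (simp add: negligible_iff_null_sets null_sets_def)
    then show "A \<in> null_sets N" using eN[OF Ab] Ab sN by (simp add: null_sets_def)
  qed
  obtain f where f: "f \<in> borel_measurable lborel" "density lborel f = N"
    using sigma_finite_measure.Radon_Nikodym[OF sigma_finite_lborel ac sN] by auto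
  have fint: "(\<integral>\<^sup>+x. f x * indicator {a..b} x \<partial>lborel) = ennreal (H b - H a)" if "a \<le> b" for a b
  proof -
    have "y \<in> H ` {a..b}" if "H a \<le> y" "y \<le> H b" for y
      using that mono[of a "J y"] mono[of "J y" b] HJ[of y] by (intro image_eqI[of y H "J y"]) auto
    then have "H ` {a..b} = {H a..H b}" by (auto simp: mono)
    then have "emeasure N {a..b} = ennreal (H b - H a)"
      using eN[of "{a..b}"] that mono by simp
    then show ?thesis using emeasure_density[of f lborel "{a..b}"] f by simp
  qed
  \<comment> \<open>The Radon-Nikodym density may take the value infinity. Its mass on each bounded
    interval is finite, so this happens only on a null set and \<open>enn2real\<close> does not
    change the integrals.\<close>
  have "AE x in lborel. \<forall>n::nat. f x * indicator {-real n..real n} x \<noteq> \<infinity>"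
    unfolding AE_all_countable
  proof
    fix n :: nat
    show "AE x in lborel. f x * indicator {-real n..real n} x \<noteq> \<infinity>"
      by (rule nn_integral_PInf_AE) (use f fint[of "-real n" "real n"] in auto)
  qed
  then have fin: "AE x in lborel. ennreal (enn2real (f x)) = f x"
  proof eventually_elim
    case (elim x)
    obtain n :: nat where "\<bar>x\<bar> \<le> real n" using real_arch_simple by blast
    then have "indicator {-real n..real n} x = (1::ennreal)" by (auto simp: indicator_def)
    then have "f x \<noteq> \<infinity>" using elim[rule_format, of n] by simp
    then show ?case by (simp add: less_top)
  qed
  have "((\<lambda>x. enn2real (f x)) has_integral (H b - H a)) {a..b}" if "a \<le> b" for a b
  proof -
    have "((\<lambda>x. enn2real (f x) * indicator {a..b} x) has_integral (H b - H a)) UNIV"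
    proof (rule nn_integral_has_integral)
      have "(\<integral>\<^sup>+x. ennreal (enn2real (f x) * indicator {a..b} x) \<partial>lborel) =
            (\<integral>\<^sup>+x. f x * indicator {a..b} x \<partial>lborel)"
        using fin by (intro nn_integral_cong_AE) (auto simp: indicator_def elim!: eventually_mono)
      then show "(\<integral>\<^sup>+x. ennreal (enn2real (f x) * indicator {a..b} x) \<partial>lborel) = ennreal (H b - H a)"
        using fint that by simp
    qed (use f that mono in auto)
    then have "((\<lambda>x. if x \<in> {a..b} then enn2real (f x) else 0) has_integral (H b - H a)) UNIV"
      by (rule has_integral_eq[rotated]) (auto simp: indicator_def)
    then show ?thesis by (simp only: has_integral_restrict_UNIV)
  qed
  then show ?thesis using that by blast
qed

text \<open>Lebesgue differentiation over boxes that have \<open>x\<close> as lower corner; on the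
  line these are the intervals to the right of \<open>x\<close>, hence only a one-sided
  derivative.\<close>

lemma indefinite_integral_right_derivative:
  fixes h H :: "real \<Rightarrow> real"
  assumes h: "\<And>a b. a \<le> b \<Longrightarrow> (h has_integral (H b - H a)) {a..b}"
  obtains N where "negligible N" "\<And>x. x \<notin> N \<Longrightarrow> ((\<lambda>s. (H (x + s) - H x) / s) \<longlongrightarrow> h x) (at_right 0)"
proof -
  have "h integrable_on cbox a b" for a b :: real
    using h[of a b] by (cases "a \<le> b") (auto simp: has_integral_integrable)
  then obtain N where N: "negligible N"
    "\<And>x e. \<lbrakk>x \<notin> N; 0 < e\<rbrakk> \<Longrightarrow> \<exists>d>0. \<forall>s. 0 < s \<and> s < d \<longrightarrow>
         norm(integral (cbox x (x + s *\<^sub>R One)) h /\<^sub>R s ^ DIM(real) - h x) < e"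
    using integrable_ccontinuous_explicit by metis
  have "((\<lambda>s. (H (x + s) - H x) / s) \<longlongrightarrow> h x) (at_right 0)" if "x \<notin> N" for x
  proof (rule tendstoI)
    fix e :: real assume "0 < e"
    then obtain d where d: "d > 0" "\<And>s. 0 < s \<Longrightarrow> s < d \<Longrightarrow>
         norm(integral (cbox x (x + s *\<^sub>R One)) h /\<^sub>R s ^ DIM(real) - h x) < e"
      using N(2)[OF \<open>x \<notin> N\<close>] by metis
    have "dist ((H (x + s) - H x) / s) (h x) < e" if "0 < s" "s < d" for s
      using d(2)[OF that] integral_unique[OF h[of x "x + s"]] that by (simp add: dist_norm divide_inverse mult.commute)
    then show "\<forall>\<^sub>F s in at_right 0. dist ((H (x + s) - H x) / s) (h x) < e"
      using d(1) by (auto simp: eventually_at_right_field intro!: exI[of _ d])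
  qed
  with N(1) that show ?thesis by blast
qed

text \<open>Left difference quotients of \<open>H\<close> are right difference quotients of
  \<open>\<lambda>x. - H (-x)\<close> at the mirrored point, so the one-sided result is applied
  twice and the second exceptional set is mirrored back.\<close>

lemma indefinite_integral_AE_derivative:
  fixes h H :: "real \<Rightarrow> real"
  assumes h: "\<And>a b. a \<le> b \<Longrightarrow> (h has_integral (H b - H a)) {a..b}"
  shows "AE x in lborel. (H has_real_derivative h x) (at x)"
proof -
  obtain N1 where N1: "negligible N1"
    "\<And>x. x \<notin> N1 \<Longrightarrow> ((\<lambda>s. (H (x + s) - H x) / s) \<longlongrightarrow> h x) (at_right 0)"
    using indefinite_integral_right_derivative[OF h] by metis
  have "((\<lambda>x. h (-x)) has_integral ((\<lambda>x. - H (-x)) b - (\<lambda>x. - H (-x)) a)) {a..b}" if "a \<le> b" for a b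
    using h[of "-b" "-a"] that has_integral_reflect_real[of h "H (-a) - H (-b)" "-a" "-b"] by simp
  then obtain N2 where N2: "negligible N2"
    "\<And>x. x \<notin> N2 \<Longrightarrow> ((\<lambda>s. (- H (- (x + s)) - - H (-x)) / s) \<longlongrightarrow> h (-x)) (at_right 0)"
    by (rule indefinite_integral_right_derivative) (assumption | blast)+
  have "negligible (uminus ` N2)"
    using N2(1) by (rule negligible_locally_Lipschitz_image[rotated])
      (auto intro!: exI[of _ "UNIV :: real set"] exI[of _ "1::real"])
  then have neg: "negligible (N1 \<union> uminus ` N2)" using N1(1) by simp
  have "(H has_real_derivative h x) (at x)" if x: "x \<notin> N1 \<union> uminus ` N2" for x
  proof -
    have "-x \<notin> N2" using x by (metis UnI2 add.inverse_inverse image_eqI)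
    from N2(2)[OF this] have "((\<lambda>s. (H (x + - s) - H x) / - s) \<longlongrightarrow> h x) (at_right 0)"
      by (simp add: minus_divide_left)
    then have "((\<lambda>s. (H (x + s) - H x) / s) \<longlongrightarrow> h x) (at_left 0)"
      by (simp add: filterlim_at_left_to_right[of _ _ "0::real"])
    with N1(2)[of x] x show ?thesis
      unfolding DERIV_def by (intro filterlim_split_at_real) auto
  qed
  then have "AE x in lebesgue. (H has_real_derivative h x) (at x)"
    using neg by (intro AE_I'[of "N1 \<union> uminus ` N2"]) (auto simp: negligible_iff_null_sets)
  then show ?thesis by (simp add: AE_completion_iff)
qed

text \<open>Adding the linear function \<open>2 * K * t\<close> makes all slopes lie between
  \<open>K\<close> and \<open>3 * K\<close>, so the sum is the primitive of a density; subtracting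
  it again does not affect differentiability. Taking \<open>K = |L| + 1\<close> keeps the lower
  slope positive.\<close>

lemma lipschitz_AE_differentiable:
  fixes G :: "real \<Rightarrow> real"
  assumes lip: "\<And>s t. \<bar>G s - G t\<bar> \<le> L * \<bar>s - t\<bar>"
  shows "AE t in lborel. \<exists>D. (G has_real_derivative D) (at t)"
proof -
  define K where "K = \<bar>L\<bar> + 1"
  have G: "\<bar>G s - G t\<bar> \<le> K * \<bar>s - t\<bar>" for s t
    by (rule order_trans[OF lip]) (auto simp: K_def intro!: mult_right_mono)
  define H where "H = (\<lambda>t. G t + 2 * K * t)"
  obtain h where h: "\<And>a b. a \<le> b \<Longrightarrow> (h has_integral (H b - H a)) {a..b}"
  proof (rule has_integral_density_of_bilipschitz[of K H "3 * K"])
    show "0 < K" by (simp add: K_def)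
    show "K * (t - s) \<le> H t - H s" "H t - H s \<le> 3 * K * (t - s)" if "s \<le> t" for s t
      using G[of s t] that unfolding H_def by (auto simp: algebra_simps abs_if split: if_splits)
  qed blast
  have "AE t in lborel. (H has_real_derivative h t) (at t)"
    by (rule indefinite_integral_AE_derivative) (rule h)
  then show ?thesis
  proof eventually_elim
    case (elim t)
    have "((\<lambda>t. H t - 2 * K * t) has_real_derivative (h t - 2 * K)) (at t)"
      by (rule derivative_eq_intros elim refl | simp)+
    then show ?case unfolding H_def by auto
  qed
qed

subsection \<open>Radial limits of bounded functions\<close>

text \<open>The second term is \<open>\<zeta> / (\<zeta> - 1/\<rho>)^2\<close>, the kernel of the
  mirror image of \<open>\<rho>\<close>. Over a common denominator the numerator is a difference of
  squares, one factor being \<open>\<rho>^2 - 1\<close>, and on the circle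
  \<open>|\<rho> * \<zeta> - 1| = |\<zeta> - \<rho>|\<close>. One further factor of size
  \<open>|\<zeta> - 1| \<le> 2 * |\<zeta> - \<rho>|\<close> turns the bound into a multiple of the
  Poisson kernel.\<close>

lemma radial_kernel_bound:
  fixes \<zeta> :: complex and \<rho> :: real
  assumes \<zeta>: "norm \<zeta> = 1" and \<rho>: "0 < \<rho>" "\<rho> < 1"
  shows "norm (\<zeta> / (\<zeta> - \<rho>)^2 - \<rho>^2 / (\<rho> * \<zeta> - 1)^2 * \<zeta>) \<le> 2 * (1 - \<rho>^2) / norm (\<zeta> - \<rho>)^3"
proof -
  define d where "d = norm (\<zeta> - \<rho>)"
  have c1: "\<zeta> * cnj \<zeta> = 1" by (metis \<zeta> complex_norm_square of_real_1 one_power2)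
  have "\<rho> * \<zeta> - 1 = - (\<zeta> * cnj (\<zeta> - \<rho>))" using c1 by (simp add: algebra_simps)
  then have d': "norm (\<rho> * \<zeta> - 1) = d" by (simp add: norm_mult \<zeta> d_def del: complex_cnj_diff)
  have dpos: "0 < d" using \<zeta> \<rho> by (auto simp: d_def)
  have nz: "\<zeta> - \<rho> \<noteq> 0" "\<rho> * \<zeta> - 1 \<noteq> 0" using dpos d' by (auto simp: d_def)
  have "\<zeta> / (\<zeta> - \<rho>)^2 - \<rho>^2 / (\<rho> * \<zeta> - 1)^2 * \<zeta>
      = \<zeta> * ((\<rho> * \<zeta> - 1)^2 - \<rho>^2 * (\<zeta> - \<rho>)^2) / ((\<zeta> - \<rho>)^2 * (\<rho> * \<zeta> - 1)^2)"
    using nz by (simp add: divide_simps) (simp add: algebra_simps)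
  also have "(\<rho> * \<zeta> - 1)^2 - \<rho>^2 * (\<zeta> - \<rho>)^2 = - (1 - \<rho>^2) * (\<rho> * (\<zeta> - \<rho>) + (\<rho> * \<zeta> - 1))"
    by (simp add: power2_eq_square algebra_simps)
  finally have "norm (\<zeta> / (\<zeta> - \<rho>)^2 - \<rho>^2 / (\<rho> * \<zeta> - 1)^2 * \<zeta>)
      = norm (complex_of_real (1 - \<rho>^2)) * norm (\<rho> * (\<zeta> - \<rho>) + (\<rho> * \<zeta> - 1)) / (d^2 * d^2)"
    by (simp add: norm_mult norm_divide norm_power \<zeta> d' flip: d_def)
       (metis norm_minus_cancel minus_diff_eq)
  also have "norm (complex_of_real (1 - \<rho>^2)) = 1 - \<rho>^2"
    using \<rho> by (subst norm_of_real) (simp add: power_le_one)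
  also have "(1 - \<rho>^2) * norm (\<rho> * (\<zeta> - \<rho>) + (\<rho> * \<zeta> - 1)) / (d^2 * d^2) \<le> (1 - \<rho>^2) * (2 * d) / (d^2 * d^2)"
  proof (intro divide_right_mono mult_left_mono)
    have "norm (\<rho> * (\<zeta> - \<rho>) + (\<rho> * \<zeta> - 1)) \<le> \<rho> * d + d"
      by (rule order_trans[OF norm_triangle_ineq]) (use \<rho> d' in \<open>simp add: norm_mult d_def\<close>)
    also have "\<dots> \<le> 2 * d" using \<rho> dpos by simp
    finally show "norm (\<rho> * (\<zeta> - \<rho>) + (\<rho> * \<zeta> - 1)) \<le> 2 * d" .
  qed (use \<rho> in \<open>auto simp: power_le_one\<close>)
  also have "\<dots> = 2 * (1 - \<rho>^2) / d^3"
    using dpos by (simp add: field_simps power2_eq_square power3_eq_cube)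
  finally show ?thesis by (simp add: d_def)
qed

text \<open>The Cauchy kernel for the derivative alone would give a logarithmically divergent bound;
  subtracting the kernel of the reflected point \<open>1 / \<rho>\<close>, which contributes nothing, leaves a
  multiple of the Poisson kernel.\<close>

lemma deriv_radial_limit_0:
  fixes F :: "complex \<Rightarrow> complex"
  assumes F: "continuous_on (cball 0 1) F" "F holomorphic_on ball 0 1"
    and small: "\<And>e. 0 < e \<Longrightarrow> \<exists>\<eta>>0. \<forall>\<zeta>. norm \<zeta> = 1 \<and> norm (\<zeta> - 1) < \<eta> \<longrightarrow> norm (F \<zeta>) \<le> e * norm (\<zeta> - 1)"
  shows "((\<lambda>\<rho>. deriv F (complex_of_real \<rho>)) \<longlongrightarrow> 0) (at_left 1)"
proof (rule tendstoI)
  fix e' :: real assume "0 < e'"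
  \<comment> \<open>The part of the circle near 1 will contribute \<open>4 * e\<close>, which is
    half of \<open>e'\<close>.\<close>
  define e where "e = e' / 8"
  have e: "0 < e" using \<open>0 < e'\<close> by (simp add: e_def)
  obtain \<eta> where \<eta>: "0 < \<eta>" "\<And>\<zeta>. norm \<zeta> = 1 \<Longrightarrow> norm (\<zeta> - 1) < \<eta> \<Longrightarrow> norm (F \<zeta>) \<le> e * norm (\<zeta> - 1)"
    using small[OF e] by metis
  have "bounded (F ` cball 0 1)"
    by (intro compact_imp_bounded compact_continuous_image F compact_cball)
  then obtain B where B: "0 < B" "\<And>z. norm z \<le> 1 \<Longrightarrow> norm (F z) \<le> B"
    unfolding bounded_pos by auto
  \<comment> \<open>Where \<open>|\<zeta> - 1| \<ge> \<eta>\<close> the distance to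
    \<open>\<rho>\<close> is at least \<open>\<eta> / 2\<close>, so the kernel is at most
    \<open>16 * (1 - \<rho>^2) / \<eta>^3\<close>; this part vanishes as \<open>\<rho>\<close> tends
    to 1.\<close>
  define C where "C = 16 * B / \<eta>^3"
  have bound: "norm (deriv F (complex_of_real \<rho>)) \<le> 4 * e + C * (1 - \<rho>^2)" if \<rho>: "0 < \<rho>" "\<rho> < 1" for \<rho>
  proof -
    have \<rho>2: "0 \<le> 1 - \<rho>^2" using \<rho> by (simp add: power_le_one)
    define K where "K = (\<lambda>\<zeta>::complex. \<zeta> / (\<zeta> - \<rho>)^2 - \<rho>^2 / (\<rho> * \<zeta> - 1)^2 * \<zeta>)"
    have nz: "\<rho> * w - 1 \<noteq> 0" if "norm w \<le> 1" for w :: complex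
    proof
      assume "\<rho> * w - 1 = 0"
      then have "\<rho> * norm w = 1" using \<rho>
        by (metis abs_of_pos eq_iff_diff_eq_0 norm_mult norm_of_real norm_one)
      moreover have "\<rho> * norm w \<le> \<rho> * 1" using that \<rho> by (intro mult_left_mono) auto
      ultimately show False using \<rho> by simp
    qed
    have "continuous_on (cball 0 1) (\<lambda>w::complex. F w * (\<rho>^2 / (\<rho> * w - 1)^2))"
      "(\<lambda>w::complex. F w * (\<rho>^2 / (\<rho> * w - 1)^2)) holomorphic_on ball 0 1"
      using F nz by (auto intro!: continuous_intros holomorphic_intros)
    note has_integral_diff[OF Cauchy_derivative_formula_cis[OF F, of \<rho>] Cauchy_theorem_cis[OF this]]
    then have "((\<lambda>t. F (cis t) * (cis t / (cis t - \<rho>)^2) - F (cis t) * (\<rho>^2 / (\<rho> * cis t - 1)^2) * cis t)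
        has_integral 2 * pi * deriv F \<rho>) {0..2*pi}" using \<rho> by simp
    then have I: "((\<lambda>t. F (cis t) * K (cis t)) has_integral 2 * pi * deriv F \<rho>) {0..2*pi}"
      by (rule has_integral_eq[rotated]) (simp only: K_def right_diff_distrib mult.assoc)
    define P where "P = (\<lambda>t. (1 - (norm (complex_of_real \<rho>))^2) / (norm (cis t - \<rho>))^2)"
    have P: "(P has_integral 2 * pi) {0..2*pi}"
      unfolding P_def by (rule Poisson_kernel_has_integral) (use \<rho> in simp)
    have "((\<lambda>t. 4 * e * P t + C * (1 - \<rho>^2)) has_integral (4 * e * (2 * pi) + C * (1 - \<rho>^2) * (2 * pi))) {0..2*pi}"
      using has_integral_add[OF has_integral_mult_right[OF P, of "4 * e"]
          has_integral_const_real[of "C * (1 - \<rho>^2)" 0 "2*pi"]] by (simp add: mult_ac)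
    moreover have "norm (F (cis t) * K (cis t)) \<le> 4 * e * P t + C * (1 - \<rho>^2)" for t
    proof -
      define d where "d = norm (cis t - \<rho>)"
      have d1: "1 - \<rho> \<le> d"
        using norm_triangle_ineq2[of "cis t" "complex_of_real \<rho>"] \<rho> by (simp add: d_def)
      have "norm (cis t - 1) \<le> d + norm (complex_of_real \<rho> - 1)"
        using norm_triangle_ineq[of "cis t - \<rho>" "\<rho> - 1"] by (simp add: d_def)
      also have "norm (complex_of_real \<rho> - 1) = 1 - \<rho>"
        using \<rho> by (metis abs_of_neg diff_less_0_iff_less minus_diff_eq norm_of_real of_real_1 of_real_diff)
      finally have d2: "norm (cis t - 1) \<le> 2 * d" using d1 by simp
      have dpos: "0 < d" using d1 \<rho> by simp
      have K: "norm (K (cis t)) \<le> 2 * (1 - \<rho>^2) / d^3"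
        unfolding K_def d_def by (rule radial_kernel_bound) (use \<rho> in auto)
      have Pt: "P t = (1 - \<rho>^2) / d^2" using \<rho> by (simp add: P_def d_def)
      have C: "0 \<le> C * (1 - \<rho>^2)" using \<rho>2 B \<eta> by (simp add: C_def)
      have P0: "0 \<le> 4 * e * P t" using e \<rho>2 by (simp add: Pt)
      show ?thesis
      proof (cases "norm (cis t - 1) < \<eta>")
        case True
        then have "norm (F (cis t)) \<le> e * norm (cis t - 1)" by (intro \<eta>) auto
        also have "\<dots> \<le> e * (2 * d)" using d2 e by (intro mult_left_mono) auto
        finally have "norm (F (cis t)) * norm (K (cis t)) \<le> (e * (2 * d)) * (2 * (1 - \<rho>^2) / d^3)"
          using K dpos e by (intro mult_mono) auto
        also have "\<dots> = 4 * e * P t"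
          using dpos by (simp add: Pt field_simps power2_eq_square power3_eq_cube)
        finally show ?thesis using C by (simp add: norm_mult)
      next
        case False
        then have "\<eta> / 2 \<le> d" using d2 by simp
        then have "(\<eta> / 2)^3 \<le> d^3" using \<eta> by (intro power_mono) auto
        then have "2 * (1 - \<rho>^2) / d^3 \<le> 2 * (1 - \<rho>^2) / (\<eta> / 2)^3"
          using \<rho>2 \<eta> by (intro divide_left_mono mult_pos_pos) (auto intro!: zero_less_power dpos)
        with K have "norm (K (cis t)) \<le> 2 * (1 - \<rho>^2) / (\<eta> / 2)^3" by linarith
        then have "norm (F (cis t)) * norm (K (cis t)) \<le> B * (2 * (1 - \<rho>^2) / (\<eta> / 2)^3)"
          using B by (intro mult_mono) auto
        also have "\<dots> = C * (1 - \<rho>^2)" by (simp add: C_def power_divide)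
        finally show ?thesis using P0 by (simp add: norm_mult)
      qed
    qed
    ultimately have "norm (2 * pi * deriv F \<rho>) \<le> 4 * e * (2 * pi) + C * (1 - \<rho>^2) * (2 * pi)"
      using I integral_norm_bound_integral[of "\<lambda>t. F (cis t) * K (cis t)" "{0..2*pi}"
          "\<lambda>t. 4 * e * P t + C * (1 - \<rho>^2)"]
      by (auto simp: has_integral_iff)
    then have "(2 * pi) * norm (deriv F \<rho>) \<le> (2 * pi) * (4 * e + C * (1 - \<rho>^2))"
      by (simp add: norm_mult algebra_simps)
    then show ?thesis by simp
  qed
  have "((\<lambda>\<rho>::real. 4 * e + C * (1 - \<rho>^2)) \<longlongrightarrow> 4 * e + C * (1 - 1^2)) (at_left 1)"
    by (intro tendsto_intros)
  then have "\<forall>\<^sub>F \<rho> in at_left 1. 4 * e + C * (1 - \<rho>^2) < e'"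
    by (rule order_tendstoD) (use e in \<open>simp add: e_def\<close>)
  moreover have "\<forall>\<^sub>F \<rho> in at_left 1. 0 < \<rho> \<and> \<rho> < (1::real)"
    by (auto simp: eventually_at_left_field intro!: exI[of _ 0])
  ultimately show "\<forall>\<^sub>F \<rho> in at_left 1. dist (deriv F (complex_of_real \<rho>)) 0 < e'"
    by eventually_elim (use bound in \<open>force simp: dist_norm\<close>)
qed

text \<open>Differentiability is measured in the angle, the conclusion in the chord. Near 1 the
  angle is the imaginary part of \<open>Ln \<zeta>\<close>, and
  \<open>|Ln \<zeta>| \<le> 2 * |\<zeta> - 1|\<close> within distance 1/2, which accounts for both
  halves in the radius.\<close>

lemma small_on_circle_of_vector_derivative_0:
  fixes F :: "complex \<Rightarrow> complex"
  assumes F: "((\<lambda>s. F (cis s)) has_vector_derivative 0) (at 0)" "F 1 = 0" and e: "0 < e"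
  shows "\<exists>\<eta>>0. \<forall>\<zeta>. norm \<zeta> = 1 \<and> norm (\<zeta> - 1) < \<eta> \<longrightarrow> norm (F \<zeta>) \<le> e * norm (\<zeta> - 1)"
proof -
  have "((\<lambda>s. F (cis s)) has_derivative (\<lambda>_. 0)) (at 0)"
    using F(1) by (simp add: has_vector_derivative_def)
  then obtain \<delta> where \<delta>: "0 < \<delta>" "\<And>s. norm (s - 0) < \<delta> \<Longrightarrow> norm (F (cis s) - F (cis 0) - 0) \<le> e / 2 * norm (s - 0)"
    unfolding has_derivative_at_alt using e by (metis half_gt_zero)
  have "norm (F \<zeta>) \<le> e * norm (\<zeta> - 1)" if \<zeta>: "norm \<zeta> = 1" "norm (\<zeta> - 1) < min (1/2) (\<delta>/2)" for \<zeta>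
  proof -
    define s where "s = Im (Ln \<zeta>)"
    have "\<zeta> \<noteq> 0" using \<zeta> by auto
    have "Re (Ln \<zeta>) = 0" using \<zeta> \<open>\<zeta> \<noteq> 0\<close> by simp
    then have "Ln \<zeta> = \<i> * s" by (simp add: complex_eq_iff s_def)
    then have cis: "\<zeta> = cis s" using exp_Ln[OF \<open>\<zeta> \<noteq> 0\<close>] by (simp add: cis_conv_exp)
    have "\<bar>s\<bar> \<le> norm (Ln \<zeta>)" unfolding s_def by (rule abs_Im_le_cmod)
    also have "\<dots> \<le> 2 * norm (\<zeta> - 1)" using norm_Ln_le[of "\<zeta> - 1"] \<zeta> by simp
    finally have s: "\<bar>s\<bar> \<le> 2 * norm (\<zeta> - 1)" .
    then have "norm (F (cis s)) \<le> e / 2 * \<bar>s\<bar>" using \<delta>(2)[of s] \<zeta> F(2) by simp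
    also have "\<dots> \<le> e / 2 * (2 * norm (\<zeta> - 1))" using s e by (intro mult_left_mono) auto
    finally show ?thesis by (simp add: cis)
  qed
  then show ?thesis using \<delta>(1) by (intro exI[of _ "min (1/2) (\<delta>/2)"]) auto
qed

lemma norm_cis_diff_le: "norm (cis s - cis t) \<le> \<bar>s - t\<bar>"
proof -
  have "norm (cis s - cis t) \<le> 1 * norm (s - t)"
  proof (rule differentiable_bound[of UNIV cis "\<lambda>x h. h *\<^sub>R (\<i> * cis x)"])
    show "(cis has_derivative (\<lambda>h. h *\<^sub>R (\<i> * cis x))) (at x within UNIV)" for x
      by (auto intro!: derivative_eq_intros)
    show "onorm (\<lambda>h. h *\<^sub>R (\<i> * cis x)) \<le> 1" for x
      by (rule onorm_le) (simp add: norm_mult)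
  qed auto
  then show ?thesis by simp
qed

theorem Fatou_radial_limit_bounded:
  fixes h :: "complex \<Rightarrow> complex"
  assumes h: "h holomorphic_on ball 0 1" and B: "\<And>z. norm z < 1 \<Longrightarrow> norm (h z) \<le> B"
  shows "AE t in lborel. \<exists>l. ((\<lambda>\<rho>. h (complex_of_real \<rho> * cis t)) \<longlongrightarrow> l) (at_left 1)"
proof -
  obtain H0 where H0: "\<And>x. x \<in> ball 0 1 \<Longrightarrow> (H0 has_field_derivative h x) (at x within ball 0 1)"
    using holomorphic_convex_primitive'[OF convex_ball open_ball h] by blast
  have B0: "0 \<le> B" using B[of 0] norm_ge_zero[of "h 0"] by (simp del: norm_ge_zero)
  have "B-lipschitz_on (ball 0 1) H0"
    using field_differentiable_bound[OF convex_ball H0, of B] B B0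
    by (intro lipschitz_onI) (auto simp: dist_norm)
  then obtain H where H: "B-lipschitz_on (cball 0 1) H" "\<And>x. x \<in> ball 0 1 \<Longrightarrow> H x = H0 x"
    using lipschitz_extend_closure[of B "ball 0 1" H0] by auto
  have contH: "continuous_on (cball 0 1) H" using H(1) by (rule lipschitz_on_continuous_on)
  have derH: "(H has_field_derivative h x) (at x)" if "x \<in> ball 0 1" for x
  proof -
    have "(H0 has_field_derivative h x) (at x)"
      using H0[OF that] by (simp add: at_within_open[OF that open_ball])
    then show ?thesis
      by (rule has_field_derivative_transform_within_open[OF _ open_ball that]) (simp add: H(2))
  qed
  define G where "G = (\<lambda>t. H (cis t))"
  have G: "norm (G s - G t) \<le> B * \<bar>s - t\<bar>" for s t
  proof -
    have "norm (G s - G t) \<le> B * norm (cis s - cis t)"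
      using lipschitz_onD[OF H(1), of "cis s" "cis t"] by (simp add: G_def dist_norm)
    also have "\<dots> \<le> B * \<bar>s - t\<bar>" using B0 by (intro mult_left_mono norm_cis_diff_le)
    finally show ?thesis .
  qed
  have "AE t in lborel. \<exists>D. ((\<lambda>t. Re (G t)) has_real_derivative D) (at t)"
    by (rule lipschitz_AE_differentiable[of _ B])
      (metis G abs_Re_le_cmod minus_complex.simps(1) order_trans)
  moreover have "AE t in lborel. \<exists>D. ((\<lambda>t. Im (G t)) has_real_derivative D) (at t)"
    by (rule lipschitz_AE_differentiable[of _ B])
      (metis G abs_Im_le_cmod minus_complex.simps(2) order_trans)
  ultimately show ?thesis
  proof eventually_elim
    case (elim t)
    then obtain D1 D2 where D: "((\<lambda>t. Re (G t)) has_real_derivative D1) (at t)"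
      "((\<lambda>t. Im (G t)) has_real_derivative D2) (at t)" by blast
    define D where "D = Complex D1 D2"
    have D: "(G has_vector_derivative D) (at t)"
      using D by (simp add: has_vector_derivative_complex_iff D_def has_real_derivative_iff_has_vector_derivative)
    \<comment> \<open>The point \<open>cis t\<close> is rotated to 1 and a linear term is
      subtracted. Since \<open>cis\<close> has derivative \<open>\<i>\<close> at 0, the slope
      \<open>D / \<i>\<close> is the one that makes \<open>F\<close> vanish to first order along the
      circle; the derivative of \<open>F\<close> then tends to 0 radially, and this says that
      \<open>h * cis t\<close> tends to \<open>A\<close>.\<close>
    define A where "A = D / \<i>"
    define F where "F = (\<lambda>z. H (z * cis t) - H (cis t) - A * (z - 1))"
    have F1: "continuous_on (cball 0 1) F"
      unfolding F_def by (intro continuous_intros continuous_on_compose2[OF contH]) (auto simp: norm_mult)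
    have F': "(F has_field_derivative h (z * cis t) * cis t - A) (at z)" if "norm z < 1" for z
      unfolding F_def
      by (rule derivative_eq_intros DERIV_chain2[OF derH] refl | use that in \<open>simp add: norm_mult\<close>)+
    then have F2: "F holomorphic_on ball 0 1"
      unfolding holomorphic_on_open[OF open_ball] by (metis mem_ball_0)
    have "((\<lambda>s. F (cis s)) has_vector_derivative (D - \<i> * A)) (at 0)"
    proof -
      have "((\<lambda>s. G (s + t)) has_vector_derivative 1 *\<^sub>R D) (at 0)"
        by (rule vector_diff_chain_at[of "\<lambda>s. s + t" 1 0 G D, unfolded o_def])
          (use D in \<open>auto intro!: derivative_eq_intros\<close>)
      moreover have "(cis has_vector_derivative \<i>) (at 0)"
        by (auto intro!: derivative_eq_intros simp: has_vector_derivative_def)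
      ultimately have "((\<lambda>s. G (s + t) - G t - A * (cis s - 1)) has_vector_derivative (1 *\<^sub>R D - 0 - A * (\<i> - 0))) (at 0)"
        by (intro has_vector_derivative_diff has_vector_derivative_const has_vector_derivative_mult_right)
      then show ?thesis by (simp add: F_def G_def cis_mult mult.commute)
    qed
    then have "((\<lambda>s. F (cis s)) has_vector_derivative 0) (at 0)" by (simp add: A_def)
    moreover have "F 1 = 0" by (simp add: F_def)
    ultimately have "((\<lambda>\<rho>. deriv F (complex_of_real \<rho>)) \<longlongrightarrow> 0) (at_left 1)"
      by (intro deriv_radial_limit_0[OF F1 F2] small_on_circle_of_vector_derivative_0)
    moreover have "\<forall>\<^sub>F \<rho> in at_left 1. 0 < \<rho> \<and> \<rho> < (1::real)"
      by (auto simp: eventually_at_left_field intro!: exI[of _ 0])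
    then have "\<forall>\<^sub>F \<rho> in at_left 1. deriv F (complex_of_real \<rho>) = h (\<rho> * cis t) * cis t - A"
      by eventually_elim (rule DERIV_imp_deriv[OF F'], simp)
    ultimately have "((\<lambda>\<rho>. h (complex_of_real \<rho> * cis t) * cis t - A) \<longlongrightarrow> 0) (at_left 1)"
      by (simp cong: tendsto_cong)
    then have "((\<lambda>\<rho>. ((h (complex_of_real \<rho> * cis t) * cis t - A) + A) / cis t) \<longlongrightarrow> (0 + A) / cis t) (at_left 1)"
      by (intro tendsto_intros) auto
    then show ?case by (auto intro!: exI[of _ "A / cis t"])
  qed
qed

subsection \<open>Jensen inequality and boundary uniqueness\<close>

lemma holomorphic_factor_zero_at:
  assumes f: "f holomorphic_on S" "open S" "connected S" and a: "a \<in> S" and nz: "z0 \<in> S" "f z0 \<noteq> 0"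
  obtains n k where "k holomorphic_on S" "k a \<noteq> 0" "\<And>z. z \<in> S \<Longrightarrow> f z = (z - a) ^ n * k z"
proof (cases "f a = 0")
  case False
  show ?thesis by (rule that[of f 0]) (use f False in auto)
next
  case True
  have "\<not> f constant_on S" unfolding constant_on_def using True a nz by metis
  then obtain g r n where g: "0 < n" "0 < r" "ball a r \<subseteq> S" "g holomorphic_on ball a r"
    "\<And>w. w \<in> ball a r \<Longrightarrow> f w = (w - a) ^ n * g w" "\<And>w. w \<in> ball a r \<Longrightarrow> g w \<noteq> 0"
    using holomorphic_factor_zero_nonconstant[OF f a True] by metis
  define k where "k = (\<lambda>z. if z \<in> ball a r then g z else f z / (z - a) ^ n)"
  have "k holomorphic_on (ball a r \<union> (S - {a}))"
    unfolding k_def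
  proof (rule holomorphic_on_If_Un)
    show "(\<lambda>z. f z / (z - a) ^ n) holomorphic_on S - {a}"
      using f(1) by (intro holomorphic_intros) (auto intro: holomorphic_on_subset)
  qed (use g f in \<open>auto simp: open_delete\<close>)
  moreover have "ball a r \<union> (S - {a}) = S" using g a by auto
  ultimately have "k holomorphic_on S" by simp
  moreover have "k a \<noteq> 0" using g by (simp add: k_def)
  moreover have "f z = (z - a) ^ n * k z" if "z \<in> S" for z
  proof (cases "z \<in> ball a r")
    case True
    then show ?thesis using g(5) by (simp add: k_def)
  next
    case False
    then have "z \<noteq> a" using g(2) by auto
    then show ?thesis using False by (simp add: k_def)
  qed
  ultimately show ?thesis using that by blast
qed

text \<open>Dividing by the full power of \<open>z - a\<close> leaves a function that is nonzero at
  \<open>a\<close>, so the number of distinct zeros in \<open>K\<close> drops. The point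
  \<open>z0\<close> rules out the zero function and remains a nonzero point of each
  quotient.\<close>

lemma holomorphic_factor_zeros_compact:
  assumes "f holomorphic_on S" "open S" "connected S" "compact K" "K \<subseteq> S" "z0 \<in> S" "f z0 \<noteq> 0"
  shows "\<exists>as F. set as \<subseteq> K \<and> F holomorphic_on S \<and> (\<forall>z\<in>K. F z \<noteq> 0)
      \<and> (\<forall>z\<in>S. f z = (\<Prod>a\<leftarrow>as. z - a) * F z)"
  using assms
proof (induction "card {z\<in>K. f z = 0}" arbitrary: f rule: less_induct)
  case less
  show ?case
  proof (cases "{z\<in>K. f z = 0} = {}")
    case True
    then show ?thesis using less.prems by (intro exI[of _ "[]"] exI[of _ f]) auto
  next
    case False
    then obtain a where a: "a \<in> K" "f a = 0" by blast
    have "\<not> f constant_on S" unfolding constant_on_def using a less.prems by (metis subsetD)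
    then have fin: "finite {z\<in>K. f z = 0}"
      using holomorphic_compact_finite_zeros less.prems by blast
    obtain n k where k: "k holomorphic_on S" "k a \<noteq> 0" "\<And>z. z \<in> S \<Longrightarrow> f z = (z - a) ^ n * k z"
    proof (rule holomorphic_factor_zero_at[of f S a z0])
      show "a \<in> S" using a less.prems by blast
    qed (use less.prems in auto)
    have "{z\<in>K. k z = 0} \<subseteq> {z\<in>K. f z = 0} - {a}" using k less.prems by auto
    moreover have "\<dots> \<subset> {z\<in>K. f z = 0}" using a by auto
    ultimately have "card {z\<in>K. k z = 0} < card {z\<in>K. f z = 0}"
      using fin by (meson psubset_card_mono subset_psubset_trans)
    moreover have "k z0 \<noteq> 0" using k(3)[of z0] less.prems by auto
    ultimately obtain as F where F: "set as \<subseteq> K" "F holomorphic_on S" "\<forall>z\<in>K. F z \<noteq> 0"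
      "\<forall>z\<in>S. k z = (\<Prod>a\<leftarrow>as. z - a) * F z"
      using less.hyps[OF _ k(1) less.prems(2-6)] by blast
    have "(\<Prod>a\<leftarrow>replicate n a @ as. z - a) = (z - a) ^ n * (\<Prod>a\<leftarrow>as. z - a)" for z
      by (simp add: map_replicate prod_list_replicate)
    then have "\<forall>z\<in>S. f z = (\<Prod>a\<leftarrow>replicate n a @ as. z - a) * F z"
      using F(4) k(3) by (simp add: mult.assoc)
    moreover have "set (replicate n a @ as) \<subseteq> K" using F(1) a by auto
    ultimately show ?thesis using F(2,3) by blast
  qed
qed

text \<open>A holomorphic logarithm lives on an open disc, while the mean value property needs it on
  the closed one; compactness provides the margin.\<close>

lemma nonvanishing_on_larger_ball:
  fixes F :: "complex \<Rightarrow> complex"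
  assumes F: "F holomorphic_on ball 0 1" and nz: "\<And>z. z \<in> cball 0 r \<Longrightarrow> F z \<noteq> 0" and r: "0 < r" "r < 1"
  obtains r' where "r < r'" "r' \<le> 1" "\<And>z. z \<in> ball 0 r' \<Longrightarrow> F z \<noteq> 0"
proof -
  define U where "U = ball 0 1 \<inter> F -` (-{0})"
  have "open U" unfolding U_def
    using continuous_open_preimage[OF holomorphic_on_imp_continuous_on[OF F] open_ball, of "-{0}"] by auto
  moreover have "cball 0 r \<subseteq> U" using nz r by (auto simp: U_def)
  ultimately obtain e where e: "0 < e" "(\<Union>x\<in>cball 0 r. ball x e) \<subseteq> U"
    using compact_subset_open_imp_ball_epsilon_subset[OF compact_cball] by metis
  have "F z \<noteq> 0" if z: "z \<in> ball 0 (min 1 (r + e))" for z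
  proof (cases "norm z \<le> r")
    case True
    then show ?thesis using nz by simp
  next
    case False
    \<comment> \<open>The radial projection of \<open>z\<close> to the circle of radius
      \<open>r\<close>; its distance from \<open>z\<close> is \<open>norm z - r\<close>, which is
      less than \<open>e\<close>.\<close>
    define x where "x = (r / norm z) *\<^sub>R z"
    have "norm x = r" using False r by (auto simp: x_def)
    moreover have "norm (x - z) = norm z - r"
    proof -
      have "x - z = (r / norm z - 1) *\<^sub>R z" by (simp add: x_def scaleR_diff_left)
      then have "norm (x - z) = \<bar>r / norm z - 1\<bar> * norm z" by simp
      also have "\<bar>r / norm z - 1\<bar> = (norm z - r) / norm z" using False r by (auto simp: abs_if diff_divide_distrib)
      finally show ?thesis using False r by auto
    qed
    ultimately have "z \<in> ball x e" "x \<in> cball 0 r" using z by (auto simp: dist_norm)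
    then have "z \<in> U" using e by blast
    then show ?thesis by (simp add: U_def)
  qed
  then show ?thesis using that[of "min 1 (r + e)"] r e by auto
qed

text \<open>On the circle \<open>r^2 = z * cnj z\<close>, so the numerator is
  \<open>z * cnj (z - a)\<close>. The zero has moved from \<open>a\<close> to its mirror image
  \<open>r^2 / cnj a\<close>.\<close>

lemma norm_reflected_factor:
  fixes a z :: complex
  assumes "norm z = r" "0 < r"
  shows "norm ((r^2 - cnj a * z) / r) = norm (z - a)"
proof -
  have "z * cnj z = r^2" using assms by (metis complex_norm_square of_real_power)
  then have "r^2 - cnj a * z = z * cnj (z - a)" by (simp add: algebra_simps)
  then show ?thesis using assms by (simp add: norm_mult norm_divide del: complex_cnj_diff)
qed

lemma norm_prod_list: "norm (prod_list xs) = prod_list (map norm xs)"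
  for xs :: "'a::real_normed_field list"
  by (induction xs) (auto simp: norm_mult)

text \<open>Replacing each factor \<open>z - a\<close> by its reflected factor keeps the modulus on
  the circle, removes all zeros from the closed disc, and at the centre replaces \<open>|a|\<close>
  by the larger \<open>\<rho>\<close>. The new function \<open>m\<close> has a holomorphic logarithm
  there, so \<open>ln |m|\<close> has the mean value property, and \<open>ln |m 0|\<close> dominates
  \<open>ln |k 0|\<close>.\<close>

lemma Jensen_inequality_circle:
  fixes k :: "complex \<Rightarrow> complex"
  assumes k: "k holomorphic_on ball 0 1" "k 0 \<noteq> 0" and \<rho>: "0 < \<rho>" "\<rho> < 1"
    and sph: "\<And>z. norm z = \<rho> \<Longrightarrow> k z \<noteq> 0"
  obtains I where "((\<lambda>t. ln (norm (k (complex_of_real \<rho> * cis t)))) has_integral I) {0..2*pi}"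
    "2 * pi * ln (norm (k 0)) \<le> I"
proof -
  obtain as F where F: "set as \<subseteq> cball 0 \<rho>" "F holomorphic_on ball 0 1" "\<And>z. z \<in> cball 0 \<rho> \<Longrightarrow> F z \<noteq> 0"
    "\<And>z. z \<in> ball 0 1 \<Longrightarrow> k z = (\<Prod>a\<leftarrow>as. z - a) * F z"
  proof -
    have "cball 0 \<rho> \<subseteq> ball (0::complex) 1" using \<rho> by auto
    from holomorphic_factor_zeros_compact[OF k(1) open_ball connected_ball compact_cball this, of 0] k(2)
    show ?thesis using that by (auto simp del: mem_cball mem_ball)
  qed
  have as: "norm a < \<rho>" if "a \<in> set as" for a
  proof -
    have "norm a \<le> \<rho>" using F(1) that by auto
    moreover from this have "k a = 0" using F(4)[of a] that \<rho> by (auto simp: prod_list_zero_iff)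
    ultimately show ?thesis using sph[of a] by fastforce
  qed
  define m where "m = (\<lambda>z. (\<Prod>a\<leftarrow>as. (\<rho>^2 - cnj a * z) / \<rho>) * F z)"
  have "(\<lambda>z. (\<Prod>a\<leftarrow>bs. (\<rho>^2 - cnj a * z) / \<rho>)) holomorphic_on ball 0 1" for bs :: "complex list"
    using \<rho> by (induction bs) (auto intro!: holomorphic_intros)
  then have mhol: "m holomorphic_on ball 0 1" unfolding m_def by (intro holomorphic_intros F)
  have mnz: "m z \<noteq> 0" if z: "z \<in> cball 0 \<rho>" for z
  proof -
    have "(\<rho>^2 - cnj a * z) / \<rho> \<noteq> 0" if "a \<in> set as" for a
    proof
      assume "(\<rho>^2 - cnj a * z) / \<rho> = 0"
      then have "cnj a * z = complex_of_real (\<rho>^2)" using \<rho> by simp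
      then have "norm a * norm z = \<rho>^2" by (metis abs_power2 complex_mod_cnj norm_mult norm_of_real)
      moreover have "norm a * norm z \<le> norm a * \<rho>" using z by (intro mult_left_mono) auto
      moreover have "norm a * \<rho> < \<rho> * \<rho>" using as[OF that] \<rho> by simp
      ultimately show False by (simp add: power2_eq_square)
    qed
    then show ?thesis using F(3)[OF z] by (auto simp: m_def prod_list_zero_iff)
  qed
  have mk: "norm (m z) = norm (k z)" if z: "norm z = \<rho>" for z
    using z \<rho> F(4)[of z]
    by (simp add: m_def norm_mult norm_prod_list o_def norm_reflected_factor[OF z \<rho>(1)] del: norm_divide)
  have "norm (k 0) \<le> norm (m 0)"
  proof -
    have "norm (k 0) = (\<Prod>a\<leftarrow>as. norm a) * norm (F 0)"
      using F(4)[of 0] by (simp add: norm_mult norm_prod_list o_def)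
    also have "\<dots> \<le> (\<Prod>a\<leftarrow>as. \<rho>) * norm (F 0)"
    proof (rule mult_right_mono)
      have "(\<Prod>a\<leftarrow>bs. norm a) \<le> (\<Prod>a\<leftarrow>bs. \<rho>) \<and> 0 \<le> (\<Prod>a\<leftarrow>bs. norm a)" if "\<forall>a\<in>set bs. norm a < \<rho>" for bs :: "complex list"
        using that \<rho> by (induction bs) (auto intro!: mult_mono)
      then show "(\<Prod>a\<leftarrow>as. norm a) \<le> (\<Prod>a\<leftarrow>as. \<rho>)" using as by blast
    qed simp
    also have "\<dots> = norm (m 0)"
      using \<rho> by (simp add: m_def norm_mult norm_prod_list o_def norm_divide norm_power power2_eq_square)
    finally show ?thesis .
  qed
  then have m0: "ln (norm (k 0)) \<le> ln (norm (m 0))" using k by (intro ln_mono) auto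
  obtain r' where r': "\<rho> < r'" "r' \<le> 1" "\<And>z. z \<in> ball 0 r' \<Longrightarrow> m z \<noteq> 0"
    using nonvanishing_on_larger_ball[OF mhol mnz \<rho>] by metis
  have "m holomorphic_on ball 0 r'" using mhol by (rule holomorphic_on_subset) (use r' in auto)
  then obtain g where g: "g holomorphic_on ball 0 r'" "\<And>x. x \<in> ball 0 r' \<Longrightarrow> exp (g x) = m x"
    using holomorphic_logarithm_exists[of "ball 0 r'" m 0] r' \<rho> by auto
  have Re_g: "Re (g z) = ln (norm (m z))" if "z \<in> ball 0 r'" for z
    using g(2)[OF that] by (metis ln_exp norm_exp_eq_Re)
  have in_r': "norm (complex_of_real \<rho> * z) < r'" if "norm z \<le> 1" for z
  proof -
    have "norm (complex_of_real \<rho> * z) \<le> \<rho> * 1" using that \<rho> by (simp add: norm_mult mult_left_le)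
    then show ?thesis using r' by simp
  qed
  have gh: "(\<lambda>z. g (complex_of_real \<rho> * z)) holomorphic_on ball 0 1"
    by (rule holomorphic_on_compose_gen[OF _ g(1), of "\<lambda>z. \<rho> * z", unfolded o_def])
      (auto intro!: holomorphic_intros in_r')
  have gc: "continuous_on (cball 0 1) (\<lambda>z. g (complex_of_real \<rho> * z))"
    by (rule continuous_on_compose2[OF holomorphic_on_imp_continuous_on[OF g(1)]])
      (auto intro!: continuous_intros in_r')
  have "((\<lambda>t. Re (g (complex_of_real \<rho> * cis t))) has_integral 2 * pi * Re (g 0)) {0..2*pi}"
    using has_integral_linear[OF mean_value_cis[OF gc gh] bounded_linear_Re]
    by (simp add: o_def)
  then have "((\<lambda>t. ln (norm (k (complex_of_real \<rho> * cis t)))) has_integral 2 * pi * Re (g 0)) {0..2*pi}"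
  proof (rule has_integral_eq[rotated])
    fix t
    have "norm (complex_of_real \<rho> * cis t) = \<rho>" using \<rho> by (simp add: norm_mult)
    then show "Re (g (complex_of_real \<rho> * cis t)) = ln (norm (k (complex_of_real \<rho> * cis t)))"
      using Re_g[of "complex_of_real \<rho> * cis t"] mk r' by simp
  qed
  moreover have "Re (g 0) = ln (norm (m 0))" using Re_g r' \<rho> by simp
  ultimately show ?thesis using that m0 by simp
qed

text \<open>A closed disc of radius below 1 contains finitely many zeros, so all but finitely many
  radii in an interval are admissible. The lower bound 1/2, the value of
  \<open>1 - 1 / (j + 2)\<close> at \<open>j = 0\<close>, keeps the circles away from the origin,
  where a power of \<open>z\<close> will be divided out.\<close>

lemma circles_without_zeros:
  fixes k :: "complex \<Rightarrow> complex"
  assumes k: "k holomorphic_on ball 0 1" "k 0 \<noteq> 0"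
  obtains \<rho> :: "nat \<Rightarrow> real" where "\<And>j. 1/2 \<le> \<rho> j" "\<And>j. \<rho> j < 1" "\<rho> \<longlonglongrightarrow> 1"
    "\<And>j z. norm z = \<rho> j \<Longrightarrow> k z \<noteq> 0"
proof -
  have "\<exists>\<rho>. 1 - 1 / (real j + 2) < \<rho> \<and> \<rho> < 1 \<and> (\<forall>z. norm z = \<rho> \<longrightarrow> k z \<noteq> 0)" for j
  proof -
    define a where "a = 1 - 1 / (real j + 2)"
    define b where "b = (1 + a) / 2"
    have a: "0 < a" "a < 1" by (auto simp: a_def field_simps)
    have ab: "a < b" "b < 1" using a by (auto simp: b_def)
    have fin: "finite {z \<in> cball 0 b. k z = 0}"
    proof (cases "k constant_on ball 0 1")
      case True
      then have "k z \<noteq> 0" if "norm z < 1" for z using k(2) that unfolding constant_on_def by fastforce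
      then have "{z \<in> cball 0 b. k z = 0} = {}" using ab by force
      then show ?thesis by (simp only: finite.emptyI)
    next
      case False
      then show ?thesis
        using ab by (intro holomorphic_compact_finite_zeros[OF k(1) open_ball connected_ball compact_cball]) auto
    qed
    have "infinite {a<..<b}" using ab by simp
    then obtain \<rho> where "\<rho> \<in> {a<..<b}" "\<rho> \<notin> norm ` {z \<in> cball 0 b. k z = 0}"
      using fin by (meson finite_imageI finite_subset subsetI)
    then show ?thesis using ab by (intro exI[of _ \<rho>]) (force simp flip: a_def)
  qed
  then obtain \<rho> where \<rho>: "\<And>j. 1 - 1 / (real j + 2) < \<rho> j" "\<And>j. \<rho> j < 1" "\<And>j z. norm z = \<rho> j \<Longrightarrow> k z \<noteq> 0"
    by metis
  have "\<rho> \<longlonglongrightarrow> 1"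
  proof (rule tendsto_sandwich)
    show "(\<lambda>j. 1 - 1 / (real j + 2)) \<longlonglongrightarrow> 1" by real_asymp
    show "\<forall>\<^sub>F j in sequentially. 1 - 1 / (real j + 2) \<le> \<rho> j" using \<rho>(1) by (simp add: less_imp_le)
    show "\<forall>\<^sub>F j in sequentially. \<rho> j \<le> 1" using \<rho>(2) by (simp add: less_imp_le)
  qed simp
  moreover have "1/2 \<le> \<rho> j" for j
  proof -
    have "1/2 \<le> 1 - 1 / (real j + 2)" by (simp add: field_simps)
    then show ?thesis using \<rho>(1)[of j] by linarith
  qed
  ultimately show ?thesis using that \<rho> by blast
qed

text \<open>By Jensen, \<open>ln |h|\<close> has circle means bounded below, so by the lemma of Fatou it cannot tend to
  \<open>-\<infinity>\<close> on a set of positive measure.\<close>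

theorem radial_limit_nonzero_AE:
  fixes h :: "complex \<Rightarrow> complex"
  assumes h: "h holomorphic_on ball 0 1" and B: "\<And>z. norm z < 1 \<Longrightarrow> norm (h z) \<le> B"
    and nz: "norm z0 < 1" "h z0 \<noteq> 0"
  shows "AE t in lborel. t \<in> {0..2*pi} \<longrightarrow> \<not> ((\<lambda>\<rho>. h (complex_of_real \<rho> * cis t)) \<longlongrightarrow> 0) (at_left 1)"
proof -
  \<comment> \<open>Jensen's inequality requires a nonzero value at the centre, so the zero of
    \<open>h\<close> at 0 is divided out. On \<open>|z| \<ge> 1/2\<close> this costs at most a
    factor \<open>2 ^ n\<close>.\<close>
  obtain n k where k: "k holomorphic_on ball 0 1" "k 0 \<noteq> 0" "\<And>z. norm z < 1 \<Longrightarrow> h z = z ^ n * k z"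
    using holomorphic_factor_zero_at[OF h open_ball connected_ball, of 0 z0] nz
    by (metis centre_in_ball diff_zero mem_ball_0 zero_less_one)
  obtain \<rho> where \<rho>: "\<And>j. 1/2 \<le> \<rho> j" "\<And>j. \<rho> j < 1" "\<rho> \<longlonglongrightarrow> 1" "\<And>j z. norm z = \<rho> j \<Longrightarrow> k z \<noteq> 0"
    using circles_without_zeros[OF k(1,2)] by metis
  have \<rho>0: "0 < \<rho> j" for j using \<rho>(1)[of j] by linarith
  have kh: "norm (k z) \<le> 2 ^ n * norm (h z)" if "1/2 \<le> norm z" "norm z < 1" for z
  proof -
    have "(1/2) ^ n * norm (k z) \<le> norm z ^ n * norm (k z)"
      using that by (intro mult_right_mono power_mono) auto
    also have "\<dots> = norm (h z)" using k(3)[OF that(2)] by (simp add: norm_mult norm_power)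
    finally show ?thesis by (simp add: field_simps power_one_over)
  qed
  define M where "M = 2 ^ n * \<bar>B\<bar> + 1"
  have M: "0 < M" by (simp add: M_def add_nonneg_pos)
  have kM: "norm (k z) \<le> M" if "1/2 \<le> norm z" "norm z < 1" for z
  proof -
    have "norm (h z) \<le> \<bar>B\<bar>" using B[OF that(2)] by linarith
    then have "2 ^ n * norm (h z) \<le> 2 ^ n * \<bar>B\<bar>" by (intro mult_left_mono) auto
    then show ?thesis using kh[OF that] unfolding M_def by linarith
  qed
  \<comment> \<open>Since \<open>M\<close> dominates \<open>|k|\<close> on these circles,
    \<open>X j\<close> is nonnegative, as the lemma of Fatou requires, and Jensen bounds its
    integral from above uniformly in \<open>j\<close>.\<close>
  define X where "X = (\<lambda>j t. ln M - ln (norm (k (complex_of_real (\<rho> j) * cis t))))"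
  have on_circle: "norm (complex_of_real (\<rho> j) * cis t) = \<rho> j" for j t
    using \<rho>0[of j] by (simp add: norm_mult)
  have knz: "k (complex_of_real (\<rho> j) * cis t) \<noteq> 0" for j t using \<rho>(4) on_circle by blast
  have X0: "0 \<le> X j t" for j t
    using kM[of "complex_of_real (\<rho> j) * cis t"] \<rho>(1)[of j] \<rho>(2)[of j] knz[of j t] M
    by (simp add: X_def on_circle)
  define u where "u = (\<lambda>j t. ennreal (X j t) * indicator {0..2*pi} t)"
  have Xm: "X j \<in> borel_measurable borel" for j
  proof (rule borel_measurable_continuous_onI)
    have "continuous_on UNIV (\<lambda>t. k (complex_of_real (\<rho> j) * cis t))"
      by (rule continuous_on_compose2[OF holomorphic_on_imp_continuous_on[OF k(1)]])
        (use on_circle \<rho>(2) in \<open>auto intro!: continuous_intros\<close>)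
    then show "continuous_on UNIV (X j)"
      unfolding X_def using knz by (intro continuous_intros) auto
  qed
  have um: "u j \<in> borel_measurable lborel" for j
    unfolding u_def using Xm by measurable
  define C where "C = 2 * pi * (ln M - ln (norm (k 0)))"
  have int: "(\<integral>\<^sup>+t. u j t \<partial>lborel) \<le> ennreal C" for j
  proof -
    obtain I where I: "((\<lambda>t. ln (norm (k (complex_of_real (\<rho> j) * cis t)))) has_integral I) {0..2*pi}"
      "2 * pi * ln (norm (k 0)) \<le> I"
    proof (rule Jensen_inequality_circle[OF k(1,2) \<rho>0 \<rho>(2)])
      show "k z \<noteq> 0" if "norm z = \<rho> j" for z using \<rho>(4) that by blast
    qed
    have "(X j has_integral (2 * pi * ln M - I)) {0..2*pi}"
      unfolding X_def
      using has_integral_diff[OF has_integral_const_real[of "ln M" 0 "2*pi"] I(1)] by simp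
    then have "(\<integral>\<^sup>+t. u j t \<partial>lborel) = ennreal (2 * pi * ln M - I)"
      unfolding u_def by (intro nn_integral_has_integral_lebesgue' X0)
    also have "\<dots> \<le> ennreal C" using I(2) by (intro ennreal_leI) (simp add: C_def algebra_simps)
    finally show ?thesis .
  qed
  have "(\<integral>\<^sup>+t. liminf (\<lambda>j. u j t) \<partial>lborel) \<le> liminf (\<lambda>j. \<integral>\<^sup>+t. u j t \<partial>lborel)"
    by (rule nn_integral_liminf) (rule um)
  also have "\<dots> \<le> ennreal C"
    by (rule Liminf_le) (auto intro: always_eventually int)
  finally have "(\<integral>\<^sup>+t. liminf (\<lambda>j. u j t) \<partial>lborel) \<noteq> \<infinity>"
    by (metis ennreal_less_top infinity_ennreal_def leD)
  then have "AE t in lborel. liminf (\<lambda>j. u j t) \<noteq> \<infinity>"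
    by (intro nn_integral_PInf_AE) (use um in measurable)
  then show ?thesis
  proof eventually_elim
    case (elim t)
    show ?case
    proof (intro impI notI)
      assume t: "t \<in> {0..2*pi}" and lim: "((\<lambda>\<rho>. h (complex_of_real \<rho> * cis t)) \<longlongrightarrow> 0) (at_left 1)"
      have "filterlim \<rho> (at_left 1) sequentially"
        using \<rho>(2,3) by (auto simp: filterlim_at less_imp_neq)
      from filterlim_compose[OF lim this]
      have "(\<lambda>j. h (complex_of_real (\<rho> j) * cis t)) \<longlonglongrightarrow> 0" .
      then have "(\<lambda>j. 2 ^ n * norm (h (complex_of_real (\<rho> j) * cis t))) \<longlonglongrightarrow> 2 ^ n * norm (0::complex)"
        by (intro tendsto_intros)
      then have lim_kh: "(\<lambda>j. 2 ^ n * norm (h (complex_of_real (\<rho> j) * cis t))) \<longlonglongrightarrow> 0" by simp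
      have "norm (k (complex_of_real (\<rho> j) * cis t)) \<le> 2 ^ n * norm (h (complex_of_real (\<rho> j) * cis t))" for j
        by (rule kh) (simp_all only: on_circle \<rho>)
      then have "(\<lambda>j. norm (k (complex_of_real (\<rho> j) * cis t))) \<longlonglongrightarrow> 0"
        by (intro tendsto_sandwich[OF _ _ tendsto_const lim_kh]) auto
      then have "filterlim (\<lambda>j. norm (k (complex_of_real (\<rho> j) * cis t))) (at_right 0) sequentially"
        using knz by (auto simp: filterlim_at)
      from filterlim_compose[OF ln_at_0 this]
      have "filterlim (\<lambda>j. ln M - ln (norm (k (complex_of_real (\<rho> j) * cis t)))) at_top sequentially"
        using filterlim_tendsto_add_at_top[OF tendsto_const[of "ln M"],
            of "\<lambda>j. - ln (norm (k (complex_of_real (\<rho> j) * cis t)))" sequentially]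
        by (simp add: filterlim_uminus_at_bot)
      then have "filterlim (\<lambda>j. X j t) at_top sequentially" by (simp add: X_def)
      then have "(\<lambda>j. ennreal (X j t)) \<longlonglongrightarrow> \<infinity>"
        by (simp add: ennreal_tendsto_top_eq_at_top)
      then have "(\<lambda>j. u j t) \<longlonglongrightarrow> \<infinity>" using t by (simp add: u_def)
      then have "liminf (\<lambda>j. u j t) = \<infinity>" by (intro lim_imp_Liminf) auto
      with elim show False by simp
    qed
  qed
qed

subsection \<open>Hardy functions as quotients of bounded functions\<close>

text \<open>The expression is the Herglotz kernel \<open>(\<zeta> + z) / (\<zeta> - z)\<close>,
  written through the Cauchy kernel so that its integrals are visibly holomorphic in
  \<open>z\<close>.\<close>

lemma Re_herglotz_kernel:
  fixes z \<zeta> :: complex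
  assumes "norm \<zeta> = 1" "norm z < 1"
  shows "Re (2 * (\<zeta> / (\<zeta> - z)) - 1) = (1 - (norm z)^2) / (norm (\<zeta> - z))^2"
proof -
  have nz: "\<zeta> - z \<noteq> 0" using assms by auto
  have "2 * (\<zeta> / (\<zeta> - z)) - 1 = (\<zeta> + z) / (\<zeta> - z)" using nz by (simp add: field_simps)
  also have "\<dots> = (\<zeta> + z) * cnj (\<zeta> - z) / complex_of_real ((norm (\<zeta> - z))^2)"
    using nz unfolding complex_norm_square by simp
  finally have "Re (2 * (\<zeta> / (\<zeta> - z)) - 1) = Re ((\<zeta> + z) * cnj (\<zeta> - z)) / (norm (\<zeta> - z))^2"
    by (simp only: Re_divide_of_real)
  moreover have "Re ((\<zeta> + z) * cnj (\<zeta> - z)) = (norm \<zeta>)^2 - (norm z)^2"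
    unfolding cmod_power2 by (simp add: power2_eq_square algebra_simps)
  ultimately show ?thesis using assms by simp
qed

text \<open>The Cauchy-type integral \<open>B\<close> of a merely continuous density is already
  holomorphic. The combination \<open>2 * B z - B 0\<close> replaces the Cauchy kernel by the
  Herglotz kernel, whose real part is the Poisson kernel.\<close>

lemma herglotz_integral:
  fixes \<phi> :: "complex \<Rightarrow> real"
  assumes \<phi>: "continuous_on (sphere 0 1) \<phi>"
  obtains U where "U holomorphic_on ball 0 1" "U 0 = complex_of_real (integral {0..2*pi} (\<lambda>t. \<phi> (cis t)))"
    "\<And>z. norm z < 1 \<Longrightarrow>
       ((\<lambda>t. \<phi> (cis t) * ((1 - (norm z)^2) / (norm (cis t - z))^2)) has_integral Re (U z)) {0..2*pi}"
proof -
  define A where "A = (\<lambda>z. contour_integral (circlepath 0 1) (\<lambda>u. complex_of_real (\<phi> u) / (u - z)))"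
  have A: "((\<lambda>u. complex_of_real (\<phi> u) / (u - z)) has_contour_integral A z) (circlepath 0 1)"
    if "norm z < 1" for z
    unfolding A_def
  proof (rule has_contour_integral_integral)
    have "continuous_on (path_image (circlepath 0 1)) (\<lambda>u. complex_of_real (\<phi> u) / (u - z))"
      using that \<phi> by (intro continuous_intros) auto
    then show "(\<lambda>u. complex_of_real (\<phi> u) / (u - z)) contour_integrable_on circlepath 0 1"
      by (rule contour_integrable_continuous_circlepath)
  qed
  have "(A has_field_derivative of_nat 1 *
      contour_integral (circlepath 0 1) (\<lambda>u. complex_of_real (\<phi> u) / (u - z)^(Suc 1))) (at z)"
    if "norm z < 1" for z
    by (rule Cauchy_next_derivative_circlepath(2)[where f = "\<lambda>u. complex_of_real (\<phi> u)"])
      (use that \<phi> A in \<open>auto intro!: continuous_intros\<close>)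
  then have Ahol: "A holomorphic_on ball 0 1"
    unfolding holomorphic_on_open[OF open_ball] by (metis mem_ball_0)
  define B where "B = (\<lambda>z. A z / \<i>)"
  have Bhol: "B holomorphic_on ball 0 1" unfolding B_def using Ahol by (intro holomorphic_intros) auto
  have B: "((\<lambda>t. complex_of_real (\<phi> (cis t)) * (cis t / (cis t - z))) has_integral B z) {0..2*pi}"
    if "norm z < 1" for z
    using circlepath_has_integral_cis[OF A[OF that]] by (simp add: B_def)
  have B0: "((\<lambda>t. complex_of_real (\<phi> (cis t))) has_integral B 0) {0..2*pi}"
    using B[of 0] by simp
  show ?thesis
  proof (rule that[of "\<lambda>z. 2 * B z - B 0"])
    show "(\<lambda>z. 2 * B z - B 0) holomorphic_on ball 0 1" using Bhol by (intro holomorphic_intros)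
    have "(\<lambda>t. \<phi> (cis t)) integrable_on {0..2*pi}"
      by (intro integrable_continuous_interval continuous_on_compose2[OF \<phi>]) (auto intro!: continuous_intros)
    then have "((\<lambda>t. complex_of_real (\<phi> (cis t))) has_integral of_real (integral {0..2*pi} (\<lambda>t. \<phi> (cis t)))) {0..2*pi}"
      by (intro has_integral_of_real integrable_integral)
    from has_integral_unique[OF B0 this]
    show "2 * B 0 - B 0 = complex_of_real (integral {0..2*pi} (\<lambda>t. \<phi> (cis t)))" by simp
    show "((\<lambda>t. \<phi> (cis t) * ((1 - (norm z)^2) / (norm (cis t - z))^2)) has_integral Re (2 * B z - B 0)) {0..2*pi}"
      if z: "norm z < 1" for z
    proof -
      have "((\<lambda>t. 2 * (complex_of_real (\<phi> (cis t)) * (cis t / (cis t - z))) - complex_of_real (\<phi> (cis t)))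
          has_integral (2 * B z - B 0)) {0..2*pi}"
        by (intro has_integral_diff has_integral_mult_right B B0 z)
      from has_integral_linear[OF this bounded_linear_Re]
      have "((\<lambda>t. Re (2 * (complex_of_real (\<phi> (cis t)) * (cis t / (cis t - z))) - complex_of_real (\<phi> (cis t))))
          has_integral Re (2 * B z - B 0)) {0..2*pi}" by (simp only: o_def)
      then show ?thesis
      proof (rule has_integral_eq[rotated])
        fix t
        have "2 * (complex_of_real (\<phi> (cis t)) * (cis t / (cis t - z))) - complex_of_real (\<phi> (cis t))
            = complex_of_real (\<phi> (cis t)) * (2 * (cis t / (cis t - z)) - 1)"
          by (simp add: algebra_simps)
        then show "Re (2 * (complex_of_real (\<phi> (cis t)) * (cis t / (cis t - z))) - complex_of_real (\<phi> (cis t)))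
            = \<phi> (cis t) * ((1 - (norm z)^2) / (norm (cis t - z))^2)"
          using Re_herglotz_kernel[of "cis t" z] z by (simp only: Re_complex_of_real norm_cis times_complex.sel Im_complex_of_real)
      qed
    qed
  qed
qed

text \<open>Up to \<open>2 * pi\<close>, the real part of the Herglotz integral \<open>U\<close> of \<open>|f|\<close> is the Poisson integral of
  \<open>|f|\<close>, hence dominates \<open>|f|\<close>; take \<open>v = 1 / (1 + U / (2 * pi))\<close>.\<close>

lemma bounded_quotient_on_closed_disc:
  fixes f :: "complex \<Rightarrow> complex"
  assumes f: "continuous_on (cball 0 1) f" "f holomorphic_on ball 0 1"
  obtains v where "v holomorphic_on ball 0 1" "\<And>z. norm z < 1 \<Longrightarrow> norm (v z) \<le> 1"
    "\<And>z. norm z < 1 \<Longrightarrow> norm (f z * v z) \<le> 1"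
    "norm (v 0) = 1 / (1 + integral {0..2*pi} (\<lambda>t. norm (f (cis t))) / (2 * pi))"
proof -
  have \<phi>: "continuous_on (sphere 0 1) (\<lambda>z. norm (f z))"
    using f(1) by (intro continuous_intros) (auto elim: continuous_on_subset)
  obtain U where U: "U holomorphic_on ball 0 1"
    "U 0 = complex_of_real (integral {0..2*pi} (\<lambda>t. norm (f (cis t))))"
    "\<And>z. norm z < 1 \<Longrightarrow>
       ((\<lambda>t. norm (f (cis t)) * ((1 - (norm z)^2) / (norm (cis t - z))^2)) has_integral Re (U z)) {0..2*pi}"
    using herglotz_integral[OF \<phi>] by blast
  have fU: "2 * pi * norm (f z) \<le> Re (U z)" if z: "norm z < 1" for z
  proof -
    note P = Poisson_formula_cis[OF f z]
    have "norm (f (cis t) * complex_of_real ((1 - (norm z)^2) / (norm (cis t - z))^2))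
        = norm (f (cis t)) * ((1 - (norm z)^2) / (norm (cis t - z))^2)" for t
      unfolding norm_mult norm_of_real using z by (simp add: power_le_one)
    then have "norm (2 * pi * f z) \<le> Re (U z)"
      using integral_norm_bound_integral[OF has_integral_integrable[OF P] has_integral_integrable[OF U(3)[OF z]]]
        integral_unique[OF P] integral_unique[OF U(3)[OF z]] by simp
    then show ?thesis by (simp add: norm_mult)
  qed
  define v where "v = (\<lambda>z. 1 / (1 + U z / (2 * pi)))"
  \<comment> \<open>One lower bound for the denominator serves both purposes: the summand 1 bounds
    \<open>v\<close>, the summand \<open>norm (f z)\<close> bounds \<open>f * v\<close>.\<close>
  have big: "1 + norm (f z) \<le> norm (1 + U z / (2 * pi))" if z: "norm z < 1" for z
  proof -
    have "Re (1 + U z / (2 * pi)) = 1 + Re (U z) / (2 * pi)"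
      by (metis Re_divide_of_real one_complex.sel(1) plus_complex.sel(1))
    then have "1 + norm (f z) \<le> Re (1 + U z / (2 * pi))" using fU[OF z] by (simp add: field_simps)
    also have "\<dots> \<le> norm (1 + U z / (2 * pi))" by (rule complex_Re_le_cmod)
    finally show ?thesis .
  qed
  have nz: "1 + U z / (2 * pi) \<noteq> 0" if "norm z < 1" for z
    using big[OF that] norm_ge_zero[of "f z"] by (auto simp del: norm_ge_zero)
  show ?thesis
  proof (rule that[of v])
    show "v holomorphic_on ball 0 1"
      unfolding v_def using U(1) nz by (intro holomorphic_intros) auto
    show "norm (v z) \<le> 1" "norm (f z * v z) \<le> 1" if z: "norm z < 1" for z
    proof -
      have p: "0 < norm (1 + U z / (2 * pi))" using nz[OF z] by simp
      then show "norm (v z) \<le> 1"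
        using big[OF z] norm_ge_zero[of "f z"] unfolding v_def norm_divide by (simp del: norm_ge_zero)
      show "norm (f z * v z) \<le> 1"
        using p big[OF z] unfolding v_def norm_divide norm_mult by simp
    qed
    have "0 \<le> integral {0..2*pi} (\<lambda>t. norm (f (cis t)))"
      by (rule Henstock_Kurzweil_Integration.integral_nonneg)
        (auto intro!: integrable_continuous_interval continuous_on_compose2[OF \<phi>] continuous_on_cis continuous_on_id)
    moreover have "1 + U 0 / (2 * pi) = complex_of_real (1 + integral {0..2*pi} (\<lambda>t. norm (f (cis t))) / (2 * pi))"
      by (simp add: U(2))
    ultimately show "norm (v 0) = 1 / (1 + integral {0..2*pi} (\<lambda>t. norm (f (cis t))) / (2 * pi))"
      unfolding v_def norm_divide by (simp only: norm_of_real) simp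
  qed
qed

text \<open>The dilates \<open>f (\<rho> n * z)\<close> are continuous on the closed disc and yield
  quotients with numerator and denominator bounded by 1, to which Montel's theorem applies. The
  Hardy bound \<open>C\<close> enters only to keep the denominators at 0 above
  \<open>1 / (1 + C / (2 * pi))\<close>, so that their limit is not the zero function.\<close>

theorem hardy1_quotient_of_bounded:
  assumes "hardy1 f"
  obtains v w where "v holomorphic_on ball 0 1" "w holomorphic_on ball 0 1"
    "\<And>z. norm z < 1 \<Longrightarrow> norm (v z) \<le> 1" "\<And>z. norm z < 1 \<Longrightarrow> norm (w z) \<le> 1"
    "v 0 \<noteq> 0" "\<And>z. norm z < 1 \<Longrightarrow> f z * v z = w z"
proof -
  obtain C where f: "f holomorphic_on ball 0 1"
    and C: "\<And>r. 0 < r \<Longrightarrow> r < 1 \<Longrightarrow> integral {0..2*pi} (\<lambda>t. norm (f (complex_of_real r * cis t))) \<le> C"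
    using assms unfolding hardy1_def by blast
  define \<rho> where "\<rho> = (\<lambda>n::nat. 1 - 1 / (real n + 2))"
  have \<rho>: "0 < \<rho> n" "\<rho> n < 1" for n by (auto simp: \<rho>_def field_simps)
  have \<rho>lim: "\<rho> \<longlonglongrightarrow> 1" unfolding \<rho>_def by real_asymp
  have in_ball: "norm (complex_of_real (\<rho> n) * z) < 1" if "norm z \<le> 1" for n z
  proof -
    have "norm (complex_of_real (\<rho> n) * z) \<le> \<rho> n * 1" using that \<rho>[of n] by (simp add: norm_mult mult_left_le)
    then show ?thesis using \<rho>[of n] by simp
  qed
  define fn where "fn = (\<lambda>n z. f (complex_of_real (\<rho> n) * z))"
  have fc: "continuous_on (cball 0 1) (fn n)" for n
    unfolding fn_def by (rule continuous_on_compose2[OF holomorphic_on_imp_continuous_on[OF f]])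
      (auto intro!: continuous_intros in_ball simp del: norm_mult)
  have fh: "fn n holomorphic_on ball 0 1" for n
    unfolding fn_def
    by (rule holomorphic_on_compose_gen[OF _ f, of "\<lambda>z. \<rho> n * z", unfolded o_def])
      (auto intro!: holomorphic_intros in_ball simp del: norm_mult)
  have "\<exists>v. v holomorphic_on ball 0 1 \<and> (\<forall>z. norm z < 1 \<longrightarrow> norm (v z) \<le> 1) \<and>
    (\<forall>z. norm z < 1 \<longrightarrow> norm (fn n z * v z) \<le> 1) \<and>
    norm (v 0) = 1 / (1 + integral {0..2*pi} (\<lambda>t. norm (fn n (cis t))) / (2 * pi))" for n
    by (rule bounded_quotient_on_closed_disc[OF fc[of n] fh[of n]]) blast
  then obtain V where V: "\<And>n. V n holomorphic_on ball 0 1" "\<And>n z. norm z < 1 \<Longrightarrow> norm (V n z) \<le> 1"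
    "\<And>n z. norm z < 1 \<Longrightarrow> norm (fn n z * V n z) \<le> 1"
    "\<And>n. norm (V n 0) = 1 / (1 + integral {0..2*pi} (\<lambda>t. norm (fn n (cis t))) / (2 * pi))"
    by metis
  define W where "W = (\<lambda>n z. fn n z * V n z)"
  have Wh: "W n holomorphic_on ball 0 1" for n unfolding W_def by (intro holomorphic_intros fh V)
  obtain v a where v: "v holomorphic_on ball 0 1" "strict_mono (a :: nat \<Rightarrow> nat)"
    "\<And>x. x \<in> ball 0 1 \<Longrightarrow> (\<lambda>n. V (a n) x) \<longlonglongrightarrow> v x"
  proof (rule Montel[of "ball 0 1" "range V" V])
    show "\<exists>B. \<forall>h\<in>range V. \<forall>z\<in>K. norm (h z) \<le> B" if "K \<subseteq> ball 0 1" for K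
      using that V(2) by (intro exI[of _ 1]) auto
  qed (use V(1) in auto)
  \<comment> \<open>The second extraction runs inside the first, so numerators and denominators
    converge along the common subsequence \<open>a (b n)\<close>.\<close>
  obtain w b where w: "w holomorphic_on ball 0 1" "strict_mono (b :: nat \<Rightarrow> nat)"
    "\<And>x. x \<in> ball 0 1 \<Longrightarrow> (\<lambda>n. W (a (b n)) x) \<longlonglongrightarrow> w x"
  proof (rule Montel[of "ball 0 1" "range (\<lambda>n. W (a n))" "\<lambda>n. W (a n)"])
    show "\<exists>B. \<forall>h\<in>range (\<lambda>n. W (a n)). \<forall>z\<in>K. norm (h z) \<le> B" if "K \<subseteq> ball 0 1" for K
      using that V(3) by (intro exI[of _ 1]) (auto simp: W_def)
  qed (use Wh in auto)
  have vb: "(\<lambda>n. V (a (b n)) x) \<longlonglongrightarrow> v x" if "norm x < 1" for x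
    using LIMSEQ_subseq_LIMSEQ[OF v(3) w(2), of x] that by (simp add: o_def)
  have sub: "filterlim (\<lambda>n. a (b n)) sequentially sequentially"
    using filterlim_compose[OF filterlim_subseq[OF v(2)] filterlim_subseq[OF w(2)]] .
  show ?thesis
  proof (rule that[OF v(1) w(1)])
    show "norm (v z) \<le> 1" if "norm z < 1" for z
      by (rule Lim_norm_ubound[OF _ vb[OF that]]) (use V(2) that in auto)
    show "norm (w z) \<le> 1" if "norm z < 1" for z
      by (rule Lim_norm_ubound[OF _ w(3)]) (use V(3) that in \<open>auto simp: W_def\<close>)
    have "0 \<le> C"
    proof -
      \<comment> \<open>Either case gives a nonnegative value, since \<open>integral\<close> is 0
        for a function that is not integrable.\<close>
      have "0 \<le> integral {0..2*pi} (\<lambda>t. norm (f (complex_of_real (1/2) * cis t)))"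
        by (cases "(\<lambda>t. norm (f (complex_of_real (1/2) * cis t))) integrable_on {0..2*pi}")
          (auto intro: Henstock_Kurzweil_Integration.integral_nonneg simp: not_integrable_integral)
      then show ?thesis using C[of "1/2"] by simp
    qed
    then have low: "1 / (1 + C / (2 * pi)) \<le> norm (V n 0)" for n
    proof -
      have "0 \<le> integral {0..2*pi} (\<lambda>t. norm (fn n (cis t)))"
        by (cases "(\<lambda>t. norm (fn n (cis t))) integrable_on {0..2*pi}")
          (auto intro: Henstock_Kurzweil_Integration.integral_nonneg simp: not_integrable_integral)
      moreover have "integral {0..2*pi} (\<lambda>t. norm (fn n (cis t))) \<le> C"
        unfolding fn_def using C \<rho> by blast
      ultimately show ?thesis unfolding V(4)
        by (intro divide_left_mono add_left_mono divide_right_mono mult_pos_pos add_pos_nonneg) auto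
    qed
    have "(\<lambda>n. norm (V (a (b n)) 0)) \<longlonglongrightarrow> norm (v 0)" by (intro tendsto_norm vb) simp
    then have "1 / (1 + C / (2 * pi)) \<le> norm (v 0)" using low by (intro LIMSEQ_le_const) auto
    moreover have "0 < 1 / (1 + C / (2 * pi))" using \<open>0 \<le> C\<close> by (simp add: add_pos_nonneg)
    ultimately show "v 0 \<noteq> 0" by auto
    show "f z * v z = w z" if z: "norm z < 1" for z
    proof (rule LIMSEQ_unique)
      show "(\<lambda>n. W (a (b n)) z) \<longlonglongrightarrow> w z" using w(3) z by simp
      have "(\<lambda>n. complex_of_real (\<rho> (a (b n))) * z) \<longlonglongrightarrow> complex_of_real 1 * z"
        by (intro tendsto_intros filterlim_compose[OF \<rho>lim sub])
      moreover have "isCont f (complex_of_real 1 * z)"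
        using holomorphic_on_imp_continuous_on[OF f] z by (simp add: continuous_on_eq_continuous_at)
      ultimately have "(\<lambda>n. fn (a (b n)) z) \<longlonglongrightarrow> f (complex_of_real 1 * z)"
        unfolding fn_def by (rule isCont_tendsto_compose[rotated])
      then show "(\<lambda>n. W (a (b n)) z) \<longlonglongrightarrow> f z * v z"
        unfolding W_def using vb[OF z] by (intro tendsto_mult) auto
    qed
  qed
qed

subsection \<open>Equal modulus on a circle\<close>

lemma poly_prod_list: "poly (\<Prod>x\<leftarrow>xs. p x) z = (\<Prod>x\<leftarrow>xs. poly (p x) z)"
  by (induction xs) auto

lemma prod_list_filter_split:
  fixes h :: "'a \<Rightarrow> 'b::comm_monoid_mult"
  shows "(\<Prod>x\<leftarrow>xs. h x) = (\<Prod>x\<leftarrow>filter P xs. h x) * (\<Prod>x\<leftarrow>filter (\<lambda>x. \<not> P x) xs. h x)"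
  by (induction xs) (auto simp: mult_ac)

text \<open>Zeros inside the circle are moved outside by reflection, which multiplies by a rational function
  unimodular on the circle; only the zeros on the circle itself remain.\<close>

lemma reflect_inner_zeros:
  fixes f :: "complex \<Rightarrow> complex"
  assumes f: "f holomorphic_on ball 0 1" and r: "0 < r" "r < 1" and nz: "norm z0 < 1" "f z0 \<noteq> 0"
  obtains A B :: "complex poly" and bs F where "A \<noteq> 0" "B \<noteq> 0" "set bs \<subseteq> sphere 0 r"
    "F holomorphic_on ball 0 1" "\<And>z. z \<in> cball 0 r \<Longrightarrow> F z \<noteq> 0"
    "\<And>z. norm z < 1 \<Longrightarrow> f z * poly A z = poly B z * ((\<Prod>b\<leftarrow>bs. z - b) * F z)"
    "\<And>z. norm z = r \<Longrightarrow> norm ((\<Prod>b\<leftarrow>bs. z - b) * F z) = norm (f z)"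
proof -
  have "cball 0 r \<subseteq> ball (0::complex) 1" using r by auto
  from holomorphic_factor_zeros_compact[where f = f, OF f open_ball connected_ball compact_cball this, of z0] nz
  obtain as F where F: "set as \<subseteq> cball 0 r" "F holomorphic_on ball 0 1" "\<And>z. z \<in> cball 0 r \<Longrightarrow> F z \<noteq> 0"
    "\<And>z. z \<in> ball 0 1 \<Longrightarrow> f z = (\<Prod>a\<leftarrow>as. z - a) * F z" by (metis mem_ball_0)
  define cs where "cs = filter (\<lambda>a. norm a < r) as"
  define bs where "bs = filter (\<lambda>a. \<not> norm a < r) as"
  \<comment> \<open>The linear polynomial is the reflected factor
    \<open>(r^2 - cnj a * z) / r\<close>. For \<open>a = 0\<close> it degenerates to the constant
    \<open>r\<close>, which is still nonzero.\<close>
  define A where "A = (\<Prod>a\<leftarrow>cs. [:complex_of_real r, - cnj a / r:])"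
  define B where "B = (\<Prod>a\<leftarrow>cs. [:- a, 1:])"
  have polyA: "poly A z = (\<Prod>a\<leftarrow>cs. (r^2 - cnj a * z) / r)" for z
  proof -
    have "poly [:complex_of_real r, - cnj a / r:] z = (r^2 - cnj a * z) / r" for a
      using r by (simp add: field_simps power2_eq_square)
    then show ?thesis unfolding A_def poly_prod_list by simp
  qed
  have polyB: "poly B z = (\<Prod>a\<leftarrow>cs. z - a)" for z
    unfolding B_def poly_prod_list by simp
  have AB: "norm (poly A z) = norm (poly B z)" if "norm z = r" for z
    by (simp add: polyA polyB norm_prod_list o_def norm_reflected_factor[OF that r(1)] del: norm_divide)
  show ?thesis
  proof (rule that[of A B bs "\<lambda>z. poly A z * F z"])
    show "A \<noteq> 0" unfolding A_def using r by (auto simp: prod_list_zero_iff)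
    show "B \<noteq> 0" unfolding B_def by (auto simp: prod_list_zero_iff)
    show "set bs \<subseteq> sphere 0 r" using F(1) by (auto simp: bs_def)
    have "poly A holomorphic_on ball 0 1"
      unfolding holomorphic_on_def field_differentiable_def
      using poly_DERIV has_field_derivative_at_within by blast
    then show "(\<lambda>z. poly A z * F z) holomorphic_on ball 0 1" using F(2) by (intro holomorphic_intros)
    show "poly A z * F z \<noteq> 0" if z: "z \<in> cball 0 r" for z
    proof -
      have "(r^2 - cnj a * z) / r \<noteq> 0" if "a \<in> set cs" for a
      proof
        assume "(r^2 - cnj a * z) / r = 0"
        then have "cnj a * z = complex_of_real (r^2)" using r by simp
        then have "norm a * norm z = r^2" by (metis abs_power2 complex_mod_cnj norm_mult norm_of_real)
        moreover have "norm a * norm z \<le> norm a * r" using z by (intro mult_left_mono) auto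
        moreover have "norm a * r < r * r" using that r by (simp add: cs_def)
        ultimately show False by (simp add: power2_eq_square)
      qed
      then show ?thesis using F(3)[OF z] by (auto simp: polyA prod_list_zero_iff)
    qed
    have fz: "f z = poly B z * ((\<Prod>b\<leftarrow>bs. z - b) * F z)" if "norm z < 1" for z
      using F(4)[of z] that prod_list_filter_split[of "\<lambda>a. z - a" as "\<lambda>a. norm a < r"]
      unfolding polyB bs_def cs_def by (simp add: mult.assoc)
    show "f z * poly A z = poly B z * ((\<Prod>b\<leftarrow>bs. z - b) * (poly A z * F z))" if "norm z < 1" for z
      using fz[OF that] by (simp add: mult_ac)
    show "norm ((\<Prod>b\<leftarrow>bs. z - b) * (poly A z * F z)) = norm (f z)" if "norm z = r" for z
    proof -
      have "norm z < 1" using that r by simp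
      from fz[OF this] show ?thesis using AB[OF that] by (simp add: norm_mult mult_ac)
    qed
  qed
qed

text \<open>The maximum principle applies to \<open>F / G\<close> and equally to
  \<open>G / F\<close>, so the quotient has modulus 1 throughout the small disc and is constant
  there; the identity theorem carries the relation to the unit disc. The auxiliary bound
  \<open>le\<close> is stated for arbitrary functions because it is used in both directions.\<close>

lemma equal_norm_nonvanishing_proportional:
  fixes F G :: "complex \<Rightarrow> complex"
  assumes F: "F holomorphic_on ball 0 1" "\<And>z. z \<in> cball 0 r \<Longrightarrow> F z \<noteq> 0"
    and G: "G holomorphic_on ball 0 1" "\<And>z. z \<in> cball 0 r \<Longrightarrow> G z \<noteq> 0"
    and r: "0 < r" "r < 1" and eq: "\<And>z. norm z = r \<Longrightarrow> norm (F z) = norm (G z)"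
  obtains c where "c \<noteq> 0" "\<And>z. norm z < 1 \<Longrightarrow> F z = c * G z"
proof -
  have le: "norm (F z / G z) \<le> 1" if z: "norm z < r"
    and F: "F holomorphic_on ball 0 1" "\<And>z. z \<in> cball 0 r \<Longrightarrow> F z \<noteq> 0"
    and G: "G holomorphic_on ball 0 1" "\<And>z. z \<in> cball 0 r \<Longrightarrow> G z \<noteq> 0"
    and eq: "\<And>z. norm z = r \<Longrightarrow> norm (F z) = norm (G z)"
    for F G :: "complex \<Rightarrow> complex" and z
  proof (rule maximum_modulus_frontier[of "\<lambda>z. F z / G z" "cball 0 r" 1 z])
    show "(\<lambda>z. F z / G z) holomorphic_on interior (cball 0 r)"
      using F G r by (intro holomorphic_intros) (auto elim: holomorphic_on_subset)
    have "(\<lambda>z. F z / G z) holomorphic_on cball 0 r"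
      using F G r by (intro holomorphic_intros) (auto elim: holomorphic_on_subset)
    then show "continuous_on (closure (cball 0 r)) (\<lambda>z. F z / G z)"
      by (simp add: holomorphic_on_imp_continuous_on)
    show "norm (F z / G z) \<le> 1" if "z \<in> frontier (cball 0 r)" for z
      using that eq[of z] r by (simp add: norm_divide frontier_cball)
  qed (use z in auto)
  have one: "norm (F z / G z) = 1" if z: "norm z < r" for z
  proof (rule antisym)
    show "norm (F z / G z) \<le> 1" by (rule le[OF z F G eq])
    have "norm (G w) = norm (F w)" if "norm w = r" for w using eq[OF that] by (rule sym)
    from le[OF z G F this] have "norm (G z / F z) \<le> 1" .
    moreover have "F z \<noteq> 0" "G z \<noteq> 0" using z F(2) G(2) by auto
    ultimately show "1 \<le> norm (F z / G z)" by (simp add: norm_divide field_simps)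
  qed
  have "(\<lambda>z. F z / G z) holomorphic_on ball 0 r"
    using F G r by (intro holomorphic_intros) (auto elim: holomorphic_on_subset)
  then have "(\<lambda>z. F z / G z) constant_on ball 0 r"
    by (rule maximum_modulus_principle[of _ _ "ball 0 r" 0]) (use one r in auto)
  then obtain c where c: "\<And>z. norm z < r \<Longrightarrow> F z / G z = c"
    unfolding constant_on_def by auto
  have "F z = c * G z" if "norm z < 1" for z
  proof (rule analytic_continuation_open[of "ball 0 r" "ball 0 1" F "\<lambda>z. c * G z"])
    show "F z = c * G z" if "z \<in> ball 0 r" for z
      using c[of z] G(2)[of z] that by auto
  qed (use F G r that in \<open>auto intro!: holomorphic_intros\<close>)
  moreover have "c \<noteq> 0" using one[of 0] c[of 0] r by auto
  ultimately show ?thesis using that by blast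
qed

text \<open>A zero \<open>a\<close> on the left is a zero on the right by equality of moduli, and
  \<open>G a\<close> is nonzero, so \<open>a\<close> occurs in \<open>bs\<close> and can be
  cancelled. Cancelling loses the equality at \<open>a\<close> itself; it is recovered by continuity
  because the circle has no isolated points.\<close>

lemma equal_norm_circle_zeros_proportional:
  fixes F G :: "complex \<Rightarrow> complex"
  assumes F: "F holomorphic_on ball 0 1" "\<And>z. z \<in> cball 0 r \<Longrightarrow> F z \<noteq> 0"
    and G: "G holomorphic_on ball 0 1" "\<And>z. z \<in> cball 0 r \<Longrightarrow> G z \<noteq> 0"
    and r: "0 < r" "r < 1"
  shows "set as \<subseteq> sphere 0 r \<Longrightarrow> set bs \<subseteq> sphere 0 r \<Longrightarrow>
    (\<And>z. norm z = r \<Longrightarrow> norm ((\<Prod>a\<leftarrow>as. z - a) * F z) = norm ((\<Prod>b\<leftarrow>bs. z - b) * G z)) \<Longrightarrow>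
    \<exists>c. c \<noteq> 0 \<and> (\<forall>z. norm z < 1 \<longrightarrow> (\<Prod>a\<leftarrow>as. z - a) * F z = c * ((\<Prod>b\<leftarrow>bs. z - b) * G z))"
proof (induction as arbitrary: bs)
  case Nil
  have "bs = []"
  proof (rule ccontr)
    assume "bs \<noteq> []"
    then have b: "hd bs \<in> set bs" by simp
    then have "norm (hd bs) = r" using Nil.prems(2) by auto
    moreover have "(\<Prod>b\<leftarrow>bs. hd bs - b) = 0" using b by (auto simp: prod_list_zero_iff)
    ultimately have "F (hd bs) = 0" using Nil.prems(3)[of "hd bs"] by simp
    then show False using F(2)[of "hd bs"] \<open>norm (hd bs) = r\<close> by simp
  qed
  obtain c where "c \<noteq> 0" "\<And>z. norm z < 1 \<Longrightarrow> F z = c * G z"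
    by (rule equal_norm_nonvanishing_proportional[OF F G r]) (use Nil.prems(3) \<open>bs = []\<close> in auto)
  then show ?case using \<open>bs = []\<close> by auto
next
  case (Cons a as)
  have a: "norm a = r" using Cons.prems(1) by simp
  then have "(\<Prod>b\<leftarrow>bs. a - b) * G a = 0" using Cons.prems(3)[of a] by simp
  then have "a \<in> set bs" using G(2)[of a] a by (auto simp: prod_list_zero_iff)
  then obtain ys zs where bs: "bs = ys @ a # zs" by (meson split_list)
  define p q where "p = (\<lambda>z. norm ((\<Prod>a\<leftarrow>as. z - a) * F z))" and "q = (\<lambda>z. norm ((\<Prod>b\<leftarrow>ys @ zs. z - b) * G z))"
  have off: "p z = q z" if z: "norm z = r" "z \<noteq> a" for z
  proof -
    have "norm (z - a) * p z = norm (z - a) * q z"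
      using Cons.prems(3)[OF z(1)] by (simp add: bs p_def q_def norm_mult mult_ac)
    then show ?thesis using z(2) by simp
  qed
  have cont: "continuous_on (ball 0 1) (\<lambda>z. (\<Prod>a\<leftarrow>xs. z - a))" for xs :: "complex list"
    by (induction xs) (auto intro!: continuous_intros)
  have pq: "p z = q z" if z: "norm z = r" for z
  proof (cases "z = a")
    case True
    have ne: "sphere 0 r \<noteq> {x}" for x :: complex
    proof
      assume "sphere 0 r = {x}"
      moreover have "z \<in> sphere 0 r" "- z \<in> sphere 0 r" using z by simp_all
      ultimately have "- z = z" by (simp only: singleton_iff)
      then show False using z r by auto
    qed
    have "connected (sphere (0::complex) r)" by (rule connected_sphere) simp
    then have lp: "z islimpt sphere 0 r" by (rule connected_imp_perfect) (use z ne in auto)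
    have zb: "z \<in> ball 0 1" using z r by simp
    have "(p \<longlongrightarrow> p z) (at z within sphere 0 r)" "(q \<longlongrightarrow> q z) (at z within sphere 0 r)"
    proof -
      have "continuous_on (ball 0 1) p" "continuous_on (ball 0 1) q"
        unfolding p_def q_def
        by (intro continuous_intros cont holomorphic_on_imp_continuous_on F G)+
      then have "isCont p z" "isCont q z" using zb by (simp_all add: continuous_on_eq_continuous_at)
      then show "(p \<longlongrightarrow> p z) (at z within sphere 0 r)" "(q \<longlongrightarrow> q z) (at z within sphere 0 r)"
        by (simp_all add: isCont_def tendsto_within_subset[of _ _ _ UNIV])
    qed
    moreover have "\<forall>\<^sub>F w in at z within sphere 0 r. p w = q w"
      unfolding eventually_at_filter by (rule always_eventually) (use True off in auto)
    ultimately have "(q \<longlongrightarrow> p z) (at z within sphere 0 r)"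
      using Lim_transform_eventually by blast
    then show ?thesis
      using tendsto_unique[OF _ _ \<open>(q \<longlongrightarrow> q z) (at z within sphere 0 r)\<close>] lp
      by (metis trivial_limit_within)
  qed (use off z in auto)
  have "\<exists>c. c \<noteq> 0 \<and> (\<forall>z. norm z < 1 \<longrightarrow> (\<Prod>a\<leftarrow>as. z - a) * F z = c * ((\<Prod>b\<leftarrow>ys @ zs. z - b) * G z))"
    by (rule Cons.IH) (use Cons.prems bs pq in \<open>auto simp: p_def q_def\<close>)
  then obtain c where c: "c \<noteq> 0" "\<And>z. norm z < 1 \<Longrightarrow> (\<Prod>a\<leftarrow>as. z - a) * F z = c * ((\<Prod>b\<leftarrow>ys @ zs. z - b) * G z)"
    by blast
  have "(\<Prod>a\<leftarrow>a # as. z - a) * F z = c * ((\<Prod>b\<leftarrow>bs. z - b) * G z)" if "norm z < 1" for z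
  proof -
    have "(\<Prod>a\<leftarrow>a # as. z - a) * F z = (z - a) * ((\<Prod>a\<leftarrow>as. z - a) * F z)" by simp
    also have "\<dots> = c * ((\<Prod>b\<leftarrow>bs. z - b) * G z)" unfolding c(2)[OF that] by (simp add: bs mult_ac)
    finally show ?thesis .
  qed
  then show ?case using c(1) by blast
qed

theorem equal_norm_on_circle_rational_ratio:
  fixes f g :: "complex \<Rightarrow> complex"
  assumes f: "f holomorphic_on ball 0 1" and g: "g holomorphic_on ball 0 1" and r: "0 < r" "r < 1"
    and nzf: "norm z1 < 1" "f z1 \<noteq> 0" and nzg: "norm z2 < 1" "g z2 \<noteq> 0"
    and eq: "\<And>z. norm z = r \<Longrightarrow> norm (f z) = norm (g z)"
  obtains P Q :: "complex poly" where "P \<noteq> 0" "Q \<noteq> 0" "\<And>z. norm z < 1 \<Longrightarrow> f z * poly Q z = g z * poly P z"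
proof -
  obtain A1 B1 :: "complex poly" and as F where 1: "A1 \<noteq> 0" "B1 \<noteq> 0" "set as \<subseteq> sphere 0 r"
    "F holomorphic_on ball 0 1" "\<And>z. z \<in> cball 0 r \<Longrightarrow> F z \<noteq> 0"
    "\<And>z. norm z < 1 \<Longrightarrow> f z * poly A1 z = poly B1 z * ((\<Prod>b\<leftarrow>as. z - b) * F z)"
    "\<And>z. norm z = r \<Longrightarrow> norm ((\<Prod>b\<leftarrow>as. z - b) * F z) = norm (f z)"
    by (rule reflect_inner_zeros[OF f r nzf]) (rule that)
  obtain A2 B2 :: "complex poly" and bs G where 2: "A2 \<noteq> 0" "B2 \<noteq> 0" "set bs \<subseteq> sphere 0 r"
    "G holomorphic_on ball 0 1" "\<And>z. z \<in> cball 0 r \<Longrightarrow> G z \<noteq> 0"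
    "\<And>z. norm z < 1 \<Longrightarrow> g z * poly A2 z = poly B2 z * ((\<Prod>b\<leftarrow>bs. z - b) * G z)"
    "\<And>z. norm z = r \<Longrightarrow> norm ((\<Prod>b\<leftarrow>bs. z - b) * G z) = norm (g z)"
    by (rule reflect_inner_zeros[OF g r nzg]) (rule that)
  have "\<exists>c. c \<noteq> 0 \<and> (\<forall>z. norm z < 1 \<longrightarrow> (\<Prod>a\<leftarrow>as. z - a) * F z = c * ((\<Prod>b\<leftarrow>bs. z - b) * G z))"
    by (rule equal_norm_circle_zeros_proportional[OF 1(4,5) 2(4,5) r 1(3) 2(3)]) (simp_all only: 1(7) 2(7) eq)
  then obtain c where c: "c \<noteq> 0" "\<And>z. norm z < 1 \<Longrightarrow> (\<Prod>a\<leftarrow>as. z - a) * F z = c * ((\<Prod>b\<leftarrow>bs. z - b) * G z)"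
    by blast
  show ?thesis
  \<comment> \<open>The reflected functions are \<open>f * A1 / B1\<close> and
    \<open>g * A2 / B2\<close>, and the first is \<open>c\<close> times the second; clearing
    denominators gives the two polynomials.\<close>
  proof (rule that[of "smult c (B1 * A2)" "A1 * B2"])
    fix z :: complex assume z: "norm z < 1"
    have "f z * poly (A1 * B2) z = (f z * poly A1 z) * poly B2 z" by simp
    also have "\<dots> = c * poly B1 z * (poly B2 z * ((\<Prod>b\<leftarrow>bs. z - b) * G z))"
      unfolding 1(6)[OF z] c(2)[OF z] by (simp add: mult_ac)
    also have "\<dots> = g z * poly (smult c (B1 * A2)) z"
      unfolding 2(6)[OF z, symmetric] by (simp add: mult_ac)
    finally show "f z * poly (A1 * B2) z = g z * poly (smult c (B1 * A2)) z" .
  qed (use 1 2 c in auto)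
qed

section \<open>Reflection in a circle\<close>

text \<open>Points of the circle are fixed by \<open>z \<mapsto> \<rho>^2 / cnj z\<close>, so both
  sides are holomorphic functions on \<open>S\<close> that extend the squared moduli from the
  circle. They agree on \<open>X\<close>, which accumulates on the compact circle inside the
  connected set \<open>S\<close>.\<close>

lemma equal_norm_on_circle_reflection:
  fixes f g :: "complex \<Rightarrow> complex"
  assumes f: "f holomorphic_on S" and g: "g holomorphic_on S" and S: "open S" "connected S"
    and refl: "\<And>z. z \<in> S \<Longrightarrow> z \<noteq> 0 \<and> complex_of_real (\<rho>^2) / cnj z \<in> S"
    and sphere: "sphere 0 \<rho> \<subseteq> S"
    and X: "X \<subseteq> sphere 0 \<rho>" "infinite X" and eq: "\<And>z. z \<in> X \<Longrightarrow> norm (f z) = norm (g z)"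
    and z: "z \<in> S"
  shows "f z * cnj (f (complex_of_real (\<rho>^2) / cnj z)) = g z * cnj (g (complex_of_real (\<rho>^2) / cnj z))"
proof -
  have hol: "(\<lambda>z. cnj (h (complex_of_real (\<rho>^2) / cnj z))) holomorphic_on S" if h: "h holomorphic_on S" for h
  proof -
    have "h holomorphic_on cnj ` (cnj ` S)" using h by (simp add: image_image)
    moreover have "open (cnj ` S)" 
    proof -
      have "cnj ` S = cnj -` S" by (force intro: image_eqI[of _ cnj "cnj _"])
      then show ?thesis using S(1) by (simp add: open_vimage continuous_on_cnj)
    qed
    ultimately have "(cnj \<circ> h \<circ> cnj) holomorphic_on cnj ` S"
      by (rule holomorphic_on_compose_cnj_cnj)
    moreover have "(\<lambda>z. complex_of_real (\<rho>^2) / z) holomorphic_on S"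
      using refl by (intro holomorphic_intros) auto
    moreover have "(\<lambda>z. complex_of_real (\<rho>^2) / z) ` S \<subseteq> cnj ` S"
    proof (rule image_subsetI)
      fix z assume "z \<in> S"
      then have "complex_of_real (\<rho>^2) / z = cnj (complex_of_real (\<rho>^2) / cnj z)" by simp
      then show "complex_of_real (\<rho>^2) / z \<in> cnj ` S" using refl[OF \<open>z \<in> S\<close>] by blast
    qed
    ultimately have "((cnj \<circ> h \<circ> cnj) \<circ> (\<lambda>z. complex_of_real (\<rho>^2) / z)) holomorphic_on S"
      by (intro holomorphic_on_compose_gen[of "\<lambda>z. complex_of_real (\<rho>^2) / z"])
    then show ?thesis by (simp add: o_def)
  qed
  define D where "D = (\<lambda>z. f z * cnj (f (complex_of_real (\<rho>^2) / cnj z)) - g z * cnj (g (complex_of_real (\<rho>^2) / cnj z)))"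
  have "D holomorphic_on S"
    unfolding D_def using f g hol[OF f] hol[OF g] by (intro holomorphic_intros)
  moreover obtain \<xi> where "\<xi> \<in> sphere 0 \<rho>" "\<xi> islimpt X"
    using X compact_sphere compact_eq_Bolzano_Weierstrass by metis
  moreover have "D z = 0" if "z \<in> X" for z
  proof -
    have nz: "z \<noteq> 0" and n: "norm z = \<rho>" using that X sphere refl by auto
    have "complex_of_real (\<rho>^2) = z * cnj z" using n by (metis complex_norm_square of_real_power)
    then have "complex_of_real (\<rho>^2) / cnj z = z" using nz by simp
    then show ?thesis using eq[OF that] by (simp add: D_def flip: complex_norm_square del: of_real_power)
  qed
  ultimately have "D z = 0"
    using analytic_continuation[of D S X \<xi> z] S X sphere z by blast
  then show ?thesis by (simp add: D_def)
qed

lemma equal_norm_on_whole_circle: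
  fixes f g :: "complex \<Rightarrow> complex"
  assumes f: "f holomorphic_on ball 0 1" and g: "g holomorphic_on ball 0 1" and r: "0 < r" "r < 1"
    and X: "X \<subseteq> sphere 0 r" "infinite X" and eq: "\<And>z. z \<in> X \<Longrightarrow> norm (f z) = norm (g z)"
    and z: "norm z = r"
  shows "norm (f z) = norm (g z)"
proof -
  \<comment> \<open>The inner radius \<open>r^2\<close> is the mirror image of the unit circle, so
    reflection in the circle of radius \<open>r\<close> maps this annulus to itself.\<close>
  define S where "S = {z::complex. r^2 < norm z \<and> norm z < 1}"
  have r2: "r^2 < r" using r by (simp add: power2_eq_square)
  have "f z * cnj (f (complex_of_real (r^2) / cnj z)) = g z * cnj (g (complex_of_real (r^2) / cnj z))"
  proof (rule equal_norm_on_circle_reflection[of f S g r X z])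
    show "f holomorphic_on S" "g holomorphic_on S"
      using f g by (auto simp: S_def elim!: holomorphic_on_subset)
    have "S = ball 0 1 - cball 0 (r^2)" by (auto simp: S_def)
    then show "open S" by (simp add: open_Diff)
    show "connected S"
      using connected_annulus(1)[where a = "0::complex" and ?r1.0 = "r^2" and ?r2.0 = 1] unfolding S_def by simp
    show "w \<noteq> 0 \<and> complex_of_real (r^2) / cnj w \<in> S" if "w \<in> S" for w
    proof -
      have w: "r^2 < norm w" "norm w < 1" using that by (auto simp: S_def)
      then have "0 < norm w" using r by (meson le_less_trans zero_le_power2)
      then have "r^2 < r^2 / norm w" "r^2 / norm w < 1" using w r by (auto simp: field_simps)
      then show ?thesis using \<open>0 < norm w\<close> by (auto simp: S_def norm_divide norm_power)
    qed
    show "sphere 0 r \<subseteq> S" "z \<in> S" using r r2 z by (auto simp: S_def)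
  qed (use X eq in auto)
  moreover have "complex_of_real (r^2) / cnj z = z"
  proof -
    have "complex_of_real (r^2) = z * cnj z" using z by (metis complex_norm_square of_real_power)
    then show ?thesis using z r by auto
  qed
  ultimately have "complex_of_real ((norm (f z))^2) = complex_of_real ((norm (g z))^2)"
    by (simp only: complex_norm_square)
  then show ?thesis by (simp only: of_real_eq_iff power2_eq_iff_nonneg norm_ge_zero)
qed

section \<open>Polynomials of equal modulus on two concentric circles\<close>

definition poly_scale :: "complex \<Rightarrow> complex poly \<Rightarrow> complex poly" where
  "poly_scale s p = pcompose p [:0, s:]"

lemma poly_poly_scale [simp]: "poly (poly_scale s p) z = poly p (s * z)"
  by (simp add: poly_scale_def poly_pcompose mult.commute)

lemma poly_eqI_cofinite:
  fixes p q :: "complex poly"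
  assumes "finite A" "\<And>z. z \<notin> A \<Longrightarrow> poly p z = poly q z"
  shows "p = q"
proof (rule ccontr)
  assume "p \<noteq> q"
  then have "finite {z. poly (p - q) z = 0}" by (intro poly_roots_finite) simp
  moreover have "UNIV \<subseteq> A \<union> {z. poly (p - q) z = 0}" using assms(2) by auto
  ultimately have "finite (UNIV :: complex set)" using assms(1) by (meson finite_UnI finite_subset)
  then show False using infinite_UNIV_char_0 by blast
qed

lemma poly_factor_order_0:
  fixes p :: "complex poly"
  assumes "p \<noteq> 0"
  obtains p0 where "poly p0 0 \<noteq> 0" "p = monom 1 (order 0 p) * p0"
proof -
  obtain q where q: "p = [:- 0, 1:] ^ order 0 p * q" "\<not> [:- 0, 1:] dvd q"
    using order_decomp[OF assms, of 0] by blast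
  have "poly q 0 \<noteq> 0" using q(2) by (simp add: poly_eq_0_iff_dvd)
  then show ?thesis using that q(1) by (simp add: monom_altdef)
qed

text \<open>The hypothesis says that \<open>p / q\<close> is invariant under scaling by
  \<open>s\<close>. After cancelling \<open>z ^ (m + n)\<close>, the values at 0 give
  \<open>s ^ n = s ^ m\<close>, and \<open>0 < s < 1\<close> makes powers injective.\<close>

lemma scaled_cross_product_order_0:
  fixes p q :: "complex poly" and s :: real
  assumes nz: "p \<noteq> 0" "q \<noteq> 0" and s: "0 < s" "s < 1"
    and eq: "\<And>z::complex. poly p z * poly q (s * z) = poly q z * poly p (s * z)"
  shows "order 0 p = order 0 q"
proof -
  define m n where "m = order 0 p" and "n = order 0 q"
  obtain p0 where p0: "poly p0 0 \<noteq> 0" "p = monom 1 m * p0"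
    unfolding m_def by (rule poly_factor_order_0[OF nz(1)])
  obtain q0 where q0: "poly q0 0 \<noteq> 0" "q = monom 1 n * q0"
    unfolding n_def by (rule poly_factor_order_0[OF nz(2)])
  have "smult (complex_of_real s ^ n) (p0 * poly_scale s q0) = smult (complex_of_real s ^ m) (q0 * poly_scale s p0)"
  proof (rule poly_eqI_cofinite[of "{0}"])
    fix z :: complex assume "z \<notin> {0}"
    have "z ^ (m + n) * (complex_of_real s ^ n * (poly p0 z * poly q0 (complex_of_real s * z))) = z ^ (m + n) * (complex_of_real s ^ m * (poly q0 z * poly p0 (complex_of_real s * z)))"
      using eq[of z] by (simp add: p0(2) q0(2) poly_monom power_mult_distrib power_add mult_ac)
    then show "poly (smult (complex_of_real s ^ n) (p0 * poly_scale s q0)) z = poly (smult (complex_of_real s ^ m) (q0 * poly_scale s p0)) z"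
      using \<open>z \<notin> {0}\<close> by auto
  qed simp
  then have "poly (smult (complex_of_real s ^ n) (p0 * poly_scale s q0)) 0 = poly (smult (complex_of_real s ^ m) (q0 * poly_scale s p0)) 0"
    by simp
  then have "complex_of_real s ^ n = complex_of_real s ^ m" using p0 q0 by simp
  then have "s ^ n = s ^ m" by (metis of_real_eq_iff of_real_power)
  then show ?thesis using s power_inject_exp'[of s n m] by (auto simp: m_def n_def)
qed

text \<open>Equal orders give \<open>p / q\<close> a finite value \<open>c\<close> at 0. Were
  \<open>p - c * q\<close> nonzero, its order at 0 would exceed that of \<open>q\<close>, against
  the equality of orders forced by scaling invariance.\<close>

lemma scaled_cross_product_proportional:
  fixes p q :: "complex poly" and s :: real
  assumes nz: "p \<noteq> 0" "q \<noteq> 0" and s: "0 < s" "s < 1"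
    and eq: "\<And>z::complex. poly p z * poly q (s * z) = poly q z * poly p (s * z)"
  obtains c where "p = smult c q"
proof -
  define m where "m = order 0 p"
  have m: "order 0 q = m" unfolding m_def using scaled_cross_product_order_0[OF assms] by simp
  obtain p0 where p0: "poly p0 0 \<noteq> 0" "p = monom 1 m * p0"
    unfolding m_def by (rule poly_factor_order_0[OF nz(1)])
  obtain q0 where q0: "poly q0 0 \<noteq> 0" "q = monom 1 m * q0"
    unfolding m[symmetric] by (rule poly_factor_order_0[OF nz(2)])
  define c where "c = poly p0 0 / poly q0 0"
  have d: "p - smult c q = monom 1 m * (p0 - smult c q0)"
    by (simp add: p0(2) q0(2) algebra_simps)
  \<comment> \<open>The difference again satisfies the cross relation with \<open>q\<close>, but vanishes to higher order at \<open>0\<close>.\<close>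
  have "p - smult c q = 0"
  proof (rule ccontr)
    assume nz': "p - smult c q \<noteq> 0"
    have "poly (p - smult c q) z * poly q (s * z) = poly q z * poly (p - smult c q) (s * z)" for z :: complex
      using eq[of z] by (simp add: algebra_simps)
    from scaled_cross_product_order_0[OF nz' nz(2) s this] m have "order 0 (p - smult c q) = m" by simp
    moreover have "order 0 (p - smult c q) = order 0 (monom (1::complex) m) + order 0 (p0 - smult c q0)"
      using nz' unfolding d by (rule order_mult)
    moreover have "order 0 (monom (1::complex) m) = m"
      using order_power_n_n[of "0::complex" m] by (simp add: monom_altdef)
    moreover have "order 0 (p0 - smult c q0) \<noteq> 0"
    proof -
      have "poly (p0 - smult c q0) 0 = 0" using q0(1) by (simp add: c_def)
      moreover have "p0 - smult c q0 \<noteq> 0" using nz' unfolding d by auto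
      ultimately show ?thesis by (simp only: order_root) simp
    qed
    ultimately show False by simp
  qed
  then show ?thesis using that[of c] by simp
qed

lemma poly_equal_norm_on_two_circles:
  fixes P Q :: "complex poly"
  assumes nz: "P \<noteq> 0" "Q \<noteq> 0" and r: "0 < r" "r < 1"
    and X: "X \<subseteq> sphere 0 r" "infinite X" "\<And>z. z \<in> X \<Longrightarrow> norm (poly P z) = norm (poly Q z)"
    and Y: "Y \<subseteq> sphere 0 1" "infinite Y" "\<And>z. z \<in> Y \<Longrightarrow> norm (poly P z) = norm (poly Q z)"
  obtains c where "norm c = 1" "P = smult c Q"
proof -
  have refl: "poly P z * cnj (poly P (complex_of_real (\<rho>^2) / cnj z)) = poly Q z * cnj (poly Q (complex_of_real (\<rho>^2) / cnj z))"
    if "0 < \<rho>" "A \<subseteq> sphere 0 \<rho>" "infinite A" "\<And>z. z \<in> A \<Longrightarrow> norm (poly P z) = norm (poly Q z)" "z \<noteq> 0" for \<rho> A z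
  proof (rule equal_norm_on_circle_reflection[of "poly P" "-{0}" "poly Q" \<rho> A z])
    show "poly P holomorphic_on - {0}" "poly Q holomorphic_on - {0}"
      unfolding holomorphic_on_def field_differentiable_def
      using poly_DERIV has_field_derivative_at_within by blast+
    show "connected (- {0::complex})" by (rule connected_punctured_universe) simp
  qed (use that in auto)
  define s where "s = r^2"
  have s: "0 < s" "s < 1" using r by (auto simp: s_def power_less_one_iff)
  \<comment> \<open>Reflection in the unit circle is undefined at 0, and at mirror images of roots
    of \<open>P * Q\<close> the factors \<open>a\<close> and \<open>b\<close> used for cancellation
    could vanish.\<close>
  define Z where "Z = insert 0 ((\<lambda>w. 1 / cnj w) ` {w. poly (P * Q) w = 0})"
  have "finite {w. poly (P * Q) w = 0}" using nz by (intro poly_roots_finite) simp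
  then have "finite Z" by (simp add: Z_def)
  have "P * poly_scale s Q = Q * poly_scale s P"
  proof (rule poly_eqI_cofinite[OF \<open>finite Z\<close>])
    fix z assume z: "z \<notin> Z"
    then have z0: "z \<noteq> 0" by (simp add: Z_def)
    have sz: "complex_of_real s * z \<noteq> 0" using s z0 by simp
    define a b where "a = cnj (poly P (1 / cnj z))" and "b = cnj (poly Q (1 / cnj z))"
    have "poly (P * Q) (1 / cnj z) \<noteq> 0"
    proof
      assume "poly (P * Q) (1 / cnj z) = 0"
      then have "1 / cnj (1 / cnj z) \<in> Z" unfolding Z_def by blast
      then show False using z z0 by simp
    qed
    then have ab: "a \<noteq> 0" "b \<noteq> 0" by (auto simp: a_def b_def)
    have e1: "poly P z * a = poly Q z * b"
      using refl[OF zero_less_one Y z0] by (simp add: a_def b_def)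
    \<comment> \<open>The mirror image of \<open>s * z\<close> in the circle of radius
      \<open>r\<close> is that of \<open>z\<close> in the unit circle. Both reflection identities
      therefore contain the same factors \<open>a\<close> and \<open>b\<close>, which drop out of
      the cross product.\<close>
    have "complex_of_real (r^2) / cnj (complex_of_real s * z) = 1 / cnj z"
      using s z0 by (simp add: s_def)
    then have e2: "poly P (s * z) * a = poly Q (s * z) * b"
      using refl[OF r(1) X sz] unfolding a_def b_def by simp
    have "(a * b) * (poly P z * poly Q (s * z)) = (poly P z * a) * (poly Q (s * z) * b)" by simp
    also have "\<dots> = (a * b) * (poly Q z * poly P (s * z))" unfolding e1 e2[symmetric] by simp
    finally show "poly (P * poly_scale s Q) z = poly (Q * poly_scale s P) z" using ab by simp
  qed
  then have "poly (P * poly_scale s Q) z = poly (Q * poly_scale s P) z" for z by simp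
  then have "poly P z * poly Q (s * z) = poly Q z * poly P (s * z)" for z :: complex by simp
  then obtain c where c: "P = smult c Q"
    by (rule scaled_cross_product_proportional[OF nz s])
  have "finite {z. poly Q z = 0}" using nz by (intro poly_roots_finite)
  then obtain z where "z \<in> Y" "poly Q z \<noteq> 0" using Y(2) by (metis (mono_tags) finite_subset mem_Collect_eq subsetI)
  then have "norm c = 1" using Y(3)[of z] by (simp add: c norm_mult)
  then show ?thesis using that c by blast
qed

subsection \<open>Boundary values of Hardy functions and the theorem\<close>

text \<open>With \<open>f = w / v\<close> for bounded \<open>v\<close> and \<open>w\<close>, both
  have nonzero radial limits almost everywhere, and so does the quotient. That \<open>w\<close> is
  not identically zero comes from \<open>z0\<close>: otherwise \<open>v\<close> would vanish near
  \<open>z0\<close>, hence everywhere, contrary to \<open>v 0 \<noteq> 0\<close>.\<close>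

lemma hardy1_radial_limit_AE:
  assumes f: "hardy1 f" and nz: "norm z0 < 1" "f z0 \<noteq> 0"
  shows "AE t in lborel. t \<in> {0..2*pi} \<longrightarrow>
    (\<exists>l. l \<noteq> 0 \<and> ((\<lambda>\<rho>. f (complex_of_real \<rho> * cis t)) \<longlongrightarrow> l) (at_left 1))"
proof -
  obtain v w where vw: "v holomorphic_on ball 0 1" "w holomorphic_on ball 0 1"
    "\<And>z. norm z < 1 \<Longrightarrow> norm (v z) \<le> 1" "\<And>z. norm z < 1 \<Longrightarrow> norm (w z) \<le> 1"
    "v 0 \<noteq> 0" "\<And>z. norm z < 1 \<Longrightarrow> f z * v z = w z"
    using hardy1_quotient_of_bounded[OF f] by blast
  have "\<exists>z. norm z < 1 \<and> w z \<noteq> 0"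
  proof (rule ccontr)
    assume "\<not> ?thesis"
    then have w0: "f z * v z = 0" if "norm z < 1" for z using vw(6) that by auto
    have "isCont f z0"
      using f nz holomorphic_on_imp_continuous_on[of f "ball 0 1"]
      by (simp add: hardy1_def continuous_on_eq_continuous_at)
    then have "\<forall>\<^sub>F z in nhds z0. f z \<noteq> 0"
      using nz(2) by (metis isContD tendsto_at_iff_tendsto_nhds tendsto_imp_eventually_ne)
    moreover have "\<forall>\<^sub>F z in nhds z0. z \<in> ball 0 1"
      using nz by (intro eventually_nhds_in_open) auto
    ultimately have ev: "\<forall>\<^sub>F z in nhds z0. v z = 0"
      by eventually_elim (use w0 in auto)
    then obtain U where U: "open U" "z0 \<in> U" "\<And>z. z \<in> U \<Longrightarrow> v z = 0"
      unfolding eventually_nhds by blast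
    have "v 0 = 0"
      by (rule analytic_continuation_open[of "U \<inter> ball 0 1" "ball 0 1" v "\<lambda>_. 0"])
        (use U nz vw in auto)
    then show False using vw(5) by simp
  qed
  then obtain z1 where z1: "norm z1 < 1" "w z1 \<noteq> 0" by blast
  have in01: "\<forall>\<^sub>F \<rho> in at_left 1. 0 < \<rho> \<and> \<rho> < (1::real)"
    by (auto simp: eventually_at_left_field intro!: exI[of _ 0])
  have "AE t in lborel. \<exists>l. ((\<lambda>\<rho>. v (complex_of_real \<rho> * cis t)) \<longlongrightarrow> l) (at_left 1)"
    by (rule Fatou_radial_limit_bounded[OF vw(1,3)])
  moreover have "AE t in lborel. \<exists>l. ((\<lambda>\<rho>. w (complex_of_real \<rho> * cis t)) \<longlongrightarrow> l) (at_left 1)"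
    by (rule Fatou_radial_limit_bounded[OF vw(2,4)])
  moreover have "AE t in lborel. t \<in> {0..2*pi} \<longrightarrow> \<not> ((\<lambda>\<rho>. v (complex_of_real \<rho> * cis t)) \<longlongrightarrow> 0) (at_left 1)"
    by (rule radial_limit_nonzero_AE[OF vw(1,3), of 0]) (use vw in auto)
  moreover have "AE t in lborel. t \<in> {0..2*pi} \<longrightarrow> \<not> ((\<lambda>\<rho>. w (complex_of_real \<rho> * cis t)) \<longlongrightarrow> 0) (at_left 1)"
    by (rule radial_limit_nonzero_AE[OF vw(2,4) z1])
  ultimately show ?thesis
  proof eventually_elim
    case (elim t)
    show ?case
    proof
      assume t: "t \<in> {0..2*pi}"
      obtain a b where a: "((\<lambda>\<rho>. v (complex_of_real \<rho> * cis t)) \<longlongrightarrow> a) (at_left 1)"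
        and b: "((\<lambda>\<rho>. w (complex_of_real \<rho> * cis t)) \<longlongrightarrow> b) (at_left 1)" using elim by blast
      have nz: "a \<noteq> 0" "b \<noteq> 0" using elim t a b by auto
      have "\<forall>\<^sub>F \<rho> in at_left 1. v (complex_of_real \<rho> * cis t) \<noteq> 0"
        using a nz(1) by (rule tendsto_imp_eventually_ne)
      with in01 have "\<forall>\<^sub>F \<rho> in at_left 1. w (complex_of_real \<rho> * cis t) / v (complex_of_real \<rho> * cis t)
          = f (complex_of_real \<rho> * cis t)"
      proof eventually_elim
        case (elim \<rho>)
        then show ?case using vw(6)[of "complex_of_real \<rho> * cis t"] by (simp add: norm_mult field_simps)
      qed
      then have "((\<lambda>\<rho>. f (complex_of_real \<rho> * cis t)) \<longlongrightarrow> b / a) (at_left 1)"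
        by (rule Lim_transform_eventually[OF tendsto_divide[OF b a nz(1)]])
      then show "\<exists>l. l \<noteq> 0 \<and> ((\<lambda>\<rho>. f (complex_of_real \<rho> * cis t)) \<longlongrightarrow> l) (at_left 1)"
        using nz by (intro exI[of _ "b / a"]) auto
    qed
  qed
qed

text \<open>On the upper half circle \<open>cis\<close> is injective because \<open>cos\<close> is,
  so a finite set of points has finitely many angles there, a null set, while \<open>{0..pi}\<close>
  has positive length.\<close>

lemma infinite_cis_image_of_AE:
  assumes "AE t in lborel. t \<in> {0..2*pi} \<longrightarrow> R (cis t)"
  shows "infinite {z \<in> sphere 0 1. R z}"
proof
  assume fin: "finite {z \<in> sphere 0 1. R z}"
  define T where "T = {t \<in> {0..pi}. R (cis t)}"
  have "inj_on cis {0..pi}"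
  proof (rule inj_onI)
    fix s t assume "s \<in> {0..pi}" "t \<in> {0..pi}" "cis s = cis t"
    moreover from this have "cos s = cos t" by (metis cis.sel(1))
    ultimately show "s = t" using cos_inj_pi[of s t] by simp
  qed
  then have "inj_on cis T" by (rule inj_on_subset) (auto simp: T_def)
  moreover have "cis ` T \<subseteq> {z \<in> sphere 0 1. R z}" by (auto simp: T_def)
  ultimately have "finite T" using fin by (meson finite_imageD finite_subset)
  then have "T \<in> null_sets lborel" by (rule finite_imp_null_set_lborel)
  then have "AE t in lborel. t \<notin> T" by (rule AE_not_in)
  with assms have "AE t in lborel. t \<notin> {0..pi}"
    by eventually_elim (auto simp: T_def)
  then have "{0..pi} \<in> null_sets lborel" by (subst AE_iff_null_sets) auto
  then show False using pi_gt_zero by (auto simp: null_sets_def ennreal_eq_0_iff)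
qed

lemma holomorphic_zero_of_infinite_zeros_on_circle:
  assumes g: "g holomorphic_on ball 0 1" and r: "r < 1" and X: "X \<subseteq> sphere 0 r" "infinite X"
    and zero: "\<And>z. z \<in> X \<Longrightarrow> g z = 0" and z: "norm z < 1"
  shows "g z = 0"
proof -
  obtain \<xi> where \<xi>: "\<xi> \<in> sphere 0 r" "\<xi> islimpt X"
    using X compact_sphere compact_eq_Bolzano_Weierstrass by metis
  show ?thesis
    by (rule analytic_continuation[OF g open_ball connected_ball _ _ \<xi>(2)]) (use X r zero z \<xi>(1) in auto)
qed

theorem theorem2p8:
  fixes f g :: "complex \<Rightarrow> complex" and X :: "complex set" and r :: real
  assumes "hardy1 f" and "hardy1 g"
    and "AE t in lborel. t \<in> {0..2*pi} \<longrightarrow>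
           norm (radial_limit f t) = norm (radial_limit g t)"
    and "0 < r" and "r < 1"
    and "X \<subseteq> sphere 0 r" and "infinite X"
    and "\<forall>z\<in>X. norm (f z) = norm (g z)"
  shows "\<exists>c. norm c = 1 \<and> (\<forall>z\<in>ball 0 1. f z = c * g z)"
proof -
  have f: "f holomorphic_on ball 0 1" and g: "g holomorphic_on ball 0 1"
    using assms(1,2) by (auto simp: hardy1_def)
  \<comment> \<open>If one function vanishes identically, the other vanishes on \<open>X\<close> and
    hence everywhere. This isolates the degenerate case, in which there is no ratio to
    study.\<close>
  have zero_iff: "(\<forall>z. norm z < 1 \<longrightarrow> f z = 0) \<longleftrightarrow> (\<forall>z. norm z < 1 \<longrightarrow> g z = 0)"
  proof -
    have X1: "norm z < 1" if "z \<in> X" for z using that assms(5,6) by auto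
    have "g z = 0" if "\<forall>z. norm z < 1 \<longrightarrow> f z = 0" "norm z < 1" for z
      by (rule holomorphic_zero_of_infinite_zeros_on_circle[OF g assms(5-7)])
        (use assms(8) X1 that in auto)
    moreover have "f z = 0" if "\<forall>z. norm z < 1 \<longrightarrow> g z = 0" "norm z < 1" for z
      by (rule holomorphic_zero_of_infinite_zeros_on_circle[OF f assms(5-7)])
        (use assms(8) X1 that in auto)
    ultimately show ?thesis by blast
  qed
  show ?thesis
  proof (cases "\<forall>z. norm z < 1 \<longrightarrow> f z = 0")
    case True
    then show ?thesis using zero_iff by (intro exI[of _ 1]) auto
  next
    case False
    then obtain z1 z2 where z1: "norm z1 < 1" "f z1 \<noteq> 0" and z2: "norm z2 < 1" "g z2 \<noteq> 0"
      using zero_iff by blast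
    have circ: "norm (f z) = norm (g z)" if "norm z = r" for z
      by (rule equal_norm_on_whole_circle[OF f g assms(4-7) _ that]) (use assms(8) in auto)
    obtain P Q :: "complex poly" where PQ: "P \<noteq> 0" "Q \<noteq> 0" "\<And>z. norm z < 1 \<Longrightarrow> f z * poly Q z = g z * poly P z"
      using equal_norm_on_circle_rational_ratio[OF f g assms(4,5) z1 z2 circ] by blast
    have "AE t in lborel. t \<in> {0..2*pi} \<longrightarrow> norm (poly P (cis t)) = norm (poly Q (cis t))"
      using assms(3) hardy1_radial_limit_AE[OF assms(1) z1] hardy1_radial_limit_AE[OF assms(2) z2]
    proof eventually_elim
      case (elim t)
      show ?case
      proof
        assume t: "t \<in> {0..2*pi}"
        obtain a b where ab: "a \<noteq> 0" "b \<noteq> 0"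
          and a: "((\<lambda>\<rho>. f (complex_of_real \<rho> * cis t)) \<longlongrightarrow> a) (at_left 1)"
          and b: "((\<lambda>\<rho>. g (complex_of_real \<rho> * cis t)) \<longlongrightarrow> b) (at_left 1)"
          using elim t by blast
        \<comment> \<open>Since \<open>radial_limit\<close> is a \<open>Lim\<close>, it can be
          evaluated only because the limits are known to exist.\<close>
        have "radial_limit f t = a" "radial_limit g t = b"
          unfolding radial_limit_def using a b by (auto intro!: tendsto_Lim)
        then have nab: "norm a = norm b" using elim t by auto
        have pl: "((\<lambda>\<rho>. poly p (complex_of_real \<rho> * cis t)) \<longlongrightarrow> poly p (cis t)) (at_left 1)" for p
        proof -
          have "((\<lambda>\<rho>. poly p (complex_of_real \<rho> * cis t)) \<longlongrightarrow> poly p (complex_of_real 1 * cis t)) (at_left 1)"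
            by (intro tendsto_intros)
          then show ?thesis by simp
        qed
        have "\<forall>\<^sub>F \<rho> in at_left 1. 0 < \<rho> \<and> \<rho> < (1::real)"
          by (auto simp: eventually_at_left_field intro!: exI[of _ 0])
        then have "\<forall>\<^sub>F \<rho> in at_left 1. f (complex_of_real \<rho> * cis t) * poly Q (complex_of_real \<rho> * cis t)
            = g (complex_of_real \<rho> * cis t) * poly P (complex_of_real \<rho> * cis t)"
          by eventually_elim (rule PQ(3), simp add: norm_mult)
        from Lim_transform_eventually[OF tendsto_mult[OF a pl] this]
        have "((\<lambda>\<rho>. g (complex_of_real \<rho> * cis t) * poly P (complex_of_real \<rho> * cis t)) \<longlongrightarrow> a * poly Q (cis t)) (at_left 1)" .
        from tendsto_unique[OF _ this tendsto_mult[OF b pl]]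
        have "a * poly Q (cis t) = b * poly P (cis t)" by simp
        then have "norm a * norm (poly Q (cis t)) = norm b * norm (poly P (cis t))" by (metis norm_mult)
        then show "norm (poly P (cis t)) = norm (poly Q (cis t))" using nab ab by simp
      qed
    qed
    from infinite_cis_image_of_AE[OF this]
    have inf1: "infinite {z \<in> sphere 0 1. norm (poly P z) = norm (poly Q z)}" .
    \<comment> \<open>At a common zero of \<open>f\<close> and \<open>g\<close> the relation
      \<open>f * Q = g * P\<close> says nothing about \<open>P\<close> and \<open>Q\<close>, so such
      points must be discarded from \<open>X\<close>.\<close>
    have "finite {z \<in> X. f z = 0}"
    proof (rule ccontr)
      assume "infinite {z \<in> X. f z = 0}"
      then have "f z1 = 0"
        by (intro holomorphic_zero_of_infinite_zeros_on_circle[OF f assms(5) _ _ _ z1(1)]) (use assms(6) in auto)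
      then show False using z1 by simp
    qed
    then have "infinite (X - {z \<in> X. f z = 0})" using assms(7) by (rule Diff_infinite_finite)
    moreover have "X - {z \<in> X. f z = 0} = {z \<in> X. f z \<noteq> 0}" by auto
    ultimately have infX: "infinite {z \<in> X. f z \<noteq> 0}" by simp
    obtain c where c: "norm c = 1" "P = smult c Q"
    proof (rule poly_equal_norm_on_two_circles[OF PQ(1,2) assms(4,5) _ infX _ _ inf1])
      show "norm (poly P z) = norm (poly Q z)" if "z \<in> {z \<in> X. f z \<noteq> 0}" for z
      proof -
        have "norm z = r" using that assms(6) by auto
        then have "norm (f z) * norm (poly Q z) = norm (f z) * norm (poly P z)"
          using PQ(3)[of z] circ[of z] assms(5) by (metis norm_mult)
        then show ?thesis using that by simp
      qed
    qed (use assms(6) in auto)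
    have "f z = c * g z" if z: "norm z < 1" for z
    proof -
      \<comment> \<open>Substituting \<open>P = c * Q\<close> gives \<open>f = c * g\<close> only
        off the roots of \<open>Q\<close>. Infinitely many points of \<open>X\<close> survive, and
        the identity theorem covers the rest of the disc.\<close>
      define D where "D = (\<lambda>z. f z - c * g z)"
      have D: "D holomorphic_on ball 0 1" unfolding D_def using f g by (intro holomorphic_intros)
      have "finite {z. poly Q z = 0}" using PQ(2) by (rule poly_roots_finite)
      then have "infinite (X - {z. poly Q z = 0})" using assms(7) by simp
      moreover have "D z = 0" if "z \<in> X - {z. poly Q z = 0}" for z
      proof -
        have "norm z < 1" using that assms(5,6) by auto
        from PQ(3)[OF this] show ?thesis using that by (simp add: D_def c(2))
      qed
      ultimately have "D z = 0"
        by (intro holomorphic_zero_of_infinite_zeros_on_circle[OF D assms(5) _ _ _ z]) (use assms(6) in auto)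
      then show ?thesis by (simp add: D_def)
    qed
    then show ?thesis using c(1) by auto
  qed
qed

end
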